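(* $\mathrm{GI}$ is polynomial-time many-one equivalent to $\mathrm{ISO}(\{\{(0,1),(1,0),(1,1)\}\})$ and to $\mathrm{ISO}_c(\{\{(0,1),(1,0),(1,1)\}\})$.
   Context: A constraint is identified with the set of tuples it accepts; thus $\{(0,1),(1,0),(1,1)\}$ is the binary constraint $x\vee y$. A constraint application of a $k$-ary constraint $C$ is $C(x_1,\dots,x_k)$ with (not necessarily distinct) variables $x_i$; with constants, the $x_i$ may also be $0$ or $1$. A set of constraint applications is interpreted as the conjunction of its members; two sets are equivalent if they are satisfied by exactly the same assignments. For a permutation $\pi$ of a variable set $X$, $\pi(S)$ is obtained by simultaneously replacing each variable $x$ by $\pi(x)$. For a set $\mathcal{C}$ of constraints, $\mathrm{ISO}(\mathcal{C})$: given two sets $S,U$ of constraint applications of $\mathcal{C}$ over the same variable set $X$, decide whether some permutation $\pi$ of $X$ makes $\pi(S)$ equivalent to $U$; $\mathrm{ISO}_c(\mathcal{C})$ is the same with constants allowed. $\mathrm{GI}$ is the graph isomorphism problem. *)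

theory Defs
  imports
    "HOL-Computational_Algebra.Polynomial"
    "HOL-Combinatorics.Permutations"
begin

section \<open>Polynomial-time many-one reductions\<close>

text \<open>
  Deterministic multi-tape Turing machines with two-way infinite tapes. The states are
  \<open>0, \<dots>, states M\<close>, where \<open>0\<close> is the start state and \<open>states M\<close> the unique halting state.
  The tape symbols are \<open>0, \<dots>, symbols M - 1\<close>, where \<open>0\<close> is the blank and \<open>1\<close>, \<open>2\<close> stand for
  the bits. The transition function maps a state and the list of scanned symbols to the next
  state and, for each tape, the symbol to be written and the head movement; only its values on
  the finitely many arguments considered in \<open>wf_tm\<close> matter.
\<close>

datatype move = MoveLeft | Stay | MoveRight

record tm =
  tapes :: nat
  symbols :: nat
  states :: nat
  delta :: "nat \<Rightarrow> nat list \<Rightarrow> nat \<times> (nat \<times> move) list"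

definition wf_tm :: "tm \<Rightarrow> bool" where
  "wf_tm M \<longleftrightarrow> 1 \<le> tapes M \<and> 3 \<le> symbols M \<and>
    (\<forall>q < states M. \<forall>rs. length rs = tapes M \<and> set rs \<subseteq> {..<symbols M} \<longrightarrow>
      (case delta M q rs of (q', as) \<Rightarrow>
        q' \<le> states M \<and> length as = tapes M \<and> fst ` set as \<subseteq> {..<symbols M}))"

type_synonym tape = "(int \<Rightarrow> nat) \<times> int"

type_synonym config = "nat \<times> tape list"

fun scan :: "tape \<Rightarrow> nat" where
  "scan (c, h) = c h"

fun shift :: "move \<Rightarrow> int" where
  "shift MoveLeft = - 1"
| "shift Stay = 0"
| "shift MoveRight = 1"

fun act :: "nat \<times> move \<Rightarrow> tape \<Rightarrow> tape" where
  "act (a, d) (c, h) = (c(h := a), h + shift d)"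

fun step :: "tm \<Rightarrow> config \<Rightarrow> config" where
  "step M (q, ts) =
    (if q = states M then (q, ts)
     else case delta M q (map scan ts) of (q', as) \<Rightarrow> (q', map2 act as ts))"

definition contents :: "bool list \<Rightarrow> int \<Rightarrow> nat" where
  "contents w i =
    (if 0 \<le> i \<and> i < int (length w) then (if w ! nat i then 2 else 1) else 0)"

definition start_config :: "tm \<Rightarrow> bool list \<Rightarrow> config" where
  "start_config M w = (0, (contents w, 0) # replicate (tapes M - 1) (contents [], 0))"

text \<open>
  Input and output are both on the first tape. Since the halting state is absorbing in
  \<^const>\<open>step\<close>, being in it after \<open>t\<close> steps means having halted within \<open>t\<close> steps.
\<close>

definition computes_within :: "tm \<Rightarrow> bool list \<Rightarrow> bool list \<Rightarrow> nat \<Rightarrow> bool" where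
  "computes_within M w v t \<longleftrightarrow>
    (case (step M ^^ t) (start_config M w) of (q, ts) \<Rightarrow>
      q = states M \<and> fst (hd ts) = contents v)"

definition polytime :: "(bool list \<Rightarrow> bool list) \<Rightarrow> bool" where
  "polytime f \<longleftrightarrow>
    (\<exists>M (p :: nat poly). wf_tm M \<and> (\<forall>w. computes_within M w (f w) (poly p (length w))))"

definition poly_reducible :: "bool list set \<Rightarrow> bool list set \<Rightarrow> bool" (infix "\<le>\<^sub>p" 50) where
  "A \<le>\<^sub>p B \<longleftrightarrow> (\<exists>f. polytime f \<and> (\<forall>w. w \<in> A \<longleftrightarrow> f w \<in> B))"

definition poly_equivalent :: "bool list set \<Rightarrow> bool list set \<Rightarrow> bool" (infix "\<equiv>\<^sub>p" 50) where
  "A \<equiv>\<^sub>p B \<longleftrightarrow> A \<le>\<^sub>p B \<and> B \<le>\<^sub>p A"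


section \<open>Self-delimiting binary encodings\<close>

text \<open>
  Numbers are encoded in unary. They only serve to name the vertices (variables) of instances
  whose vertex (variable) set \<open>{0, \<dots>, n - 1}\<close> is itself part of the input and has size \<open>n\<close>, or
  to name one of a fixed number of constraints, so this enlarges the input at most
  polynomially.
\<close>

definition enc_nat :: "nat \<Rightarrow> bool list" where
  "enc_nat n = replicate n True @ [False]"

definition enc_list :: "('a \<Rightarrow> bool list) \<Rightarrow> 'a list \<Rightarrow> bool list" where
  "enc_list e xs = concat (map (\<lambda>x. True # e x) xs) @ [False]"

text \<open>Prefix-freeness, which makes concatenations of encodings uniquely decodable.\<close>

lemma enc_nat_prefix_free: "enc_nat m @ u = enc_nat n @ v \<longleftrightarrow> m = n \<and> u = v"
  unfolding enc_nat_def
proof (induction m arbitrary: n)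
  case 0
  then show ?case by (cases n) auto
next
  case (Suc m)
  then show ?case by (cases n) auto
qed

lemma enc_list_prefix_free:
  assumes "\<And>x y u v. e x @ u = e y @ v \<longleftrightarrow> x = y \<and> u = v"
  shows "enc_list e xs @ u = enc_list e ys @ v \<longleftrightarrow> xs = ys \<and> u = v"
  unfolding enc_list_def
proof (induction xs arbitrary: ys)
  case Nil
  then show ?case by (cases ys) auto
next
  case (Cons x xs)
  then show ?case using assms by (cases ys) auto
qed


section \<open>Graph isomorphism\<close>

text \<open>
  The pair \<open>(n, es)\<close> represents the finite simple undirected graph with vertex set
  \<open>{0, \<dots>, n - 1}\<close> and the edges \<open>{u, v}\<close> for \<open>(u, v)\<close> in \<open>es\<close>; order and repetition in the
  list, and the orientation of the pairs, are immaterial.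
\<close>

type_synonym graph_rep = "nat \<times> (nat \<times> nat) list"

fun wf_graph :: "graph_rep \<Rightarrow> bool" where
  "wf_graph (n, es) \<longleftrightarrow> (\<forall>(u, v) \<in> set es. u < n \<and> v < n \<and> u \<noteq> v)"

fun verts :: "graph_rep \<Rightarrow> nat set" where
  "verts (n, es) = {..<n}"

fun edges :: "graph_rep \<Rightarrow> nat set set" where
  "edges (n, es) = (\<lambda>(u, v). {u, v}) ` set es"

definition graph_isomorphic :: "graph_rep \<Rightarrow> graph_rep \<Rightarrow> bool" where
  "graph_isomorphic G H \<longleftrightarrow>
    (\<exists>f. bij_betw f (verts G) (verts H) \<and>
      (\<forall>u \<in> verts G. \<forall>v \<in> verts G. {u, v} \<in> edges G \<longleftrightarrow> {f u, f v} \<in> edges H))"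

definition enc_edge :: "nat \<times> nat \<Rightarrow> bool list" where
  "enc_edge e = enc_nat (fst e) @ enc_nat (snd e)"

definition enc_graph :: "graph_rep \<Rightarrow> bool list" where
  "enc_graph G = enc_nat (fst G) @ enc_list enc_edge (snd G)"

definition GI :: "bool list set" where
  "GI = {enc_graph G @ enc_graph H | G H. wf_graph G \<and> wf_graph H \<and> graph_isomorphic G H}"


section \<open>Constraint isomorphism\<close>

text \<open>A \<open>k\<close>-ary constraint is the set of the \<open>k\<close>-tuples (lists of length \<open>k\<close>) it accepts.\<close>

type_synonym constraint = "bool list set"

datatype arg = Var nat | Const bool

type_synonym application = "constraint \<times> arg list"

text \<open>
  The applications of members of \<open>\<C>\<close> to arguments from \<open>T\<close>. The inclusion says that the
  number of arguments is the arity of \<open>C\<close> (the empty constraint is considered to have every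
  arity).
\<close>

definition applications :: "constraint set \<Rightarrow> arg set \<Rightarrow> application set" where
  "applications \<C> T = {(C, xs). C \<in> \<C> \<and> C \<subseteq> {t. length t = length xs} \<and> set xs \<subseteq> T}"

fun arg_val :: "(nat \<Rightarrow> bool) \<Rightarrow> arg \<Rightarrow> bool" where
  "arg_val \<alpha> (Var x) = \<alpha> x"
| "arg_val \<alpha> (Const b) = b"

definition satisfies :: "(nat \<Rightarrow> bool) \<Rightarrow> application set \<Rightarrow> bool" where
  "satisfies \<alpha> S \<longleftrightarrow> (\<forall>(C, xs) \<in> S. map (arg_val \<alpha>) xs \<in> C)"

definition equivalent :: "application set \<Rightarrow> application set \<Rightarrow> bool" where
  "equivalent S U \<longleftrightarrow> (\<forall>\<alpha>. satisfies \<alpha> S \<longleftrightarrow> satisfies \<alpha> U)"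

fun rename_arg :: "(nat \<Rightarrow> nat) \<Rightarrow> arg \<Rightarrow> arg" where
  "rename_arg \<pi> (Var x) = Var (\<pi> x)"
| "rename_arg \<pi> (Const b) = Const b"

definition rename :: "(nat \<Rightarrow> nat) \<Rightarrow> application set \<Rightarrow> application set" where
  "rename \<pi> S = (\<lambda>(C, xs). (C, map (rename_arg \<pi>) xs)) ` S"

definition isomorphic_over :: "nat set \<Rightarrow> application set \<Rightarrow> application set \<Rightarrow> bool" where
  "isomorphic_over X S U \<longleftrightarrow> (\<exists>\<pi>. \<pi> permutes X \<and> equivalent (rename \<pi> S) U)"

text \<open>
  To write down instances, a finite set of constraints is given as a list \<open>Cs\<close>, an application
  names its constraint by the position in \<open>Cs\<close>, and a set of applications is listed in arbitrary
  order, possibly with repetitions. The variable set is \<open>{0, \<dots>, n - 1}\<close>.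
\<close>

type_synonym application_rep = "nat \<times> arg list"

definition apps_of :: "constraint list \<Rightarrow> application_rep list \<Rightarrow> application set" where
  "apps_of Cs as = (\<lambda>(i, xs). (Cs ! i, xs)) ` set as"

definition valid_apps :: "constraint list \<Rightarrow> arg set \<Rightarrow> application_rep list \<Rightarrow> bool" where
  "valid_apps Cs T as \<longleftrightarrow>
    (\<forall>(i, xs) \<in> set as. i < length Cs) \<and> apps_of Cs as \<subseteq> applications (set Cs) T"

fun enc_arg :: "arg \<Rightarrow> bool list" where
  "enc_arg (Var x) = True # enc_nat x"
| "enc_arg (Const b) = [False, b]"

definition enc_app :: "application_rep \<Rightarrow> bool list" where
  "enc_app a = enc_nat (fst a) @ enc_list enc_arg (snd a)"

definition enc_iso :: "nat \<Rightarrow> application_rep list \<Rightarrow> application_rep list \<Rightarrow> bool list" where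
  "enc_iso n as bs = enc_nat n @ enc_list enc_app as @ enc_list enc_app bs"

definition ISO :: "constraint list \<Rightarrow> bool list set" where
  "ISO Cs = {enc_iso n as bs | n as bs.
    valid_apps Cs (Var ` {..<n}) as \<and> valid_apps Cs (Var ` {..<n}) bs \<and>
    isomorphic_over {..<n} (apps_of Cs as) (apps_of Cs bs)}"

definition ISO\<^sub>c :: "constraint list \<Rightarrow> bool list set" where
  "ISO\<^sub>c Cs = {enc_iso n as bs | n as bs.
    valid_apps Cs (Var ` {..<n} \<union> range Const) as \<and>
    valid_apps Cs (Var ` {..<n} \<union> range Const) bs \<and>
    isomorphic_over {..<n} (apps_of Cs as) (apps_of Cs bs)}"

lemma enc_graph_prefix_free: "enc_graph G @ u = enc_graph H @ v \<longleftrightarrow> G = H \<and> u = v"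
proof -
  have "enc_edge d @ u = enc_edge e @ v \<longleftrightarrow> d = e \<and> u = v" for d e u v
    by (auto simp: enc_edge_def enc_nat_prefix_free prod_eq_iff)
  then show ?thesis
    by (auto simp: enc_graph_def enc_nat_prefix_free enc_list_prefix_free prod_eq_iff)
qed

lemma enc_iso_inject: "enc_iso n as bs = enc_iso n' as' bs' \<longleftrightarrow> n = n' \<and> as = as' \<and> bs = bs'"
proof -
  have "enc_arg x @ u = enc_arg y @ v \<longleftrightarrow> x = y \<and> u = v" for x y u v
    by (cases x; cases y) (auto simp: enc_nat_prefix_free)
  then have "enc_app a @ u = enc_app b @ v \<longleftrightarrow> a = b \<and> u = v" for a b u v
    by (auto simp: enc_app_def enc_nat_prefix_free enc_list_prefix_free prod_eq_iff)
  then have "enc_list enc_app as @ u = enc_list enc_app bs @ v \<longleftrightarrow> as = bs \<and> u = v"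
    for as bs u v
    by (rule enc_list_prefix_free)
  from this[where u = "[]" and v = "[]"] this show ?thesis
    by (auto simp: enc_iso_def enc_nat_prefix_free)
qed

end

theory Submission
  imports Defs
begin

text \<open>
  A graph on \<open>{0, \<dots>, n - 1}\<close> becomes the set of clauses \<open>x\<^sub>u \<or> x\<^sub>v\<close> for its edges; the edges can be
  recovered, since \<open>{u, v}\<close> is an edge iff the assignment that is false exactly at \<open>u\<close> and \<open>v\<close>
  violates the set. Conversely, a set of clauses over \<open>x\<^sub>0, \<dots>, x\<^bsub>n-1\<^esub>\<close> becomes the graph on
  \<open>{0, \<dots>, n + 1}\<close> whose edges are the pairs \<open>{i, j}\<close> such that the set implies \<open>x\<^sub>i \<or> x\<^sub>j\<close>, where
  \<open>x\<^sub>n\<close> and \<open>x\<^bsub>n+1\<^esub>\<close> are fresh. The neighbours of a fresh vertex are the dominating vertices, so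
  every isomorphism can be modified to fix the fresh vertices and then permutes the variables.

  Both maps are computed by programs that read the input once, append to the output and use a
  fixed number of counters, each bounded by the length of the input plus 2. On an input of
  length \<open>l\<close> with \<open>K\<close> counters there are \<open>O(l\<^bsup>K+1\<^esup>)\<close> possible combinations of program counter,
  remaining input and counter values, and none can recur in a computation that halts. Hence the
  running time is polynomial.
\<close>

text \<open>The clauses are positive, so a set implies x_i or x_j iff it fails at the single
  assignment that is false exactly at i and j. Edges are thus found by evaluation instead of
  inference, one clause at a time. The obstacle is that simple graphs have no loops, whereas x or x
  and, with constants, 0 or 0 are clauses. A variable that is forced to be true becomes adjacent to
  all other vertices. The first fresh vertex separates it from a variable that merely shares a
  clause with each other variable: in the satisfiable case fresh vertices are adjacent to forced
  variables only. The second fresh vertex records unsatisfiability: with only one, "all variables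
  are true" and "false" would both give the complete graph, while the edge between two fresh
  vertices occurs only for the latter. The summand 2 in the counter bound makes room for their
  number n + 2. Words that encode no instance must stay outside the target language. Hence programs
  can fail, and failure yields the empty word, which encodes nothing.\<close>

datatype test = Never | Sees "bool option" | Pos nat | And test test

datatype com =
    Skip
  | Fail
  | Read
  | Out bool
  | Inc nat
  | Dec nat
  | Seq com com (infixr ";;" 60)
  | If test com com
  | While test com

type_synonym store = "bool list \<times> bool list \<times> (nat \<Rightarrow> nat)"

fun peek :: "bool list \<Rightarrow> bool option" where
  "peek [] = None"
| "peek (b # r) = Some b"

fun holds :: "test \<Rightarrow> store \<Rightarrow> bool" where
  "holds Never s = False"
| "holds (Sees x) (r, u, C) = (peek r = x)"
| "holds (Pos j) (r, u, C) = (0 < C j)"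
| "holds (And t t') s = (holds t s \<and> holds t' s)"

text \<open>In this big-step relation divergence is the absence of a derivation and
  \<open>None\<close> stands for failure. Only \<open>Inc\<close> can enlarge a counter, so the
  bounds are premises of that rule alone, and every derivation certifies the space bound on which
  the running time estimate rests.\<close>

inductive exec :: "nat \<Rightarrow> nat \<Rightarrow> com \<Rightarrow> store \<Rightarrow> store option \<Rightarrow> bool" for K B where
  Skip: "exec K B Skip s (Some s)"
| Fail: "exec K B Fail s None"
| Read: "exec K B Read (b # r, u, C) (Some (r, u, C))"
| Out: "exec K B (Out b) (r, u, C) (Some (r, u @ [b], C))"
| Inc: "j < K \<Longrightarrow> C j < B \<Longrightarrow> exec K B (Inc j) (r, u, C) (Some (r, u, C(j := Suc (C j))))"
| Dec: "exec K B (Dec j) (r, u, C) (Some (r, u, C(j := C j - 1)))"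
| Seq: "exec K B c s (Some s') \<Longrightarrow> exec K B d s' x \<Longrightarrow> exec K B (c ;; d) s x"
| Seq_None: "exec K B c s None \<Longrightarrow> exec K B (c ;; d) s None"
| If_True: "holds t s \<Longrightarrow> exec K B c s x \<Longrightarrow> exec K B (If t c d) s x"
| If_False: "\<not> holds t s \<Longrightarrow> exec K B d s x \<Longrightarrow> exec K B (If t c d) s x"
| While_False: "\<not> holds t s \<Longrightarrow> exec K B (While t c) s (Some s)"
| While_True: "holds t s \<Longrightarrow> exec K B c s (Some s') \<Longrightarrow> exec K B (While t c) s' x \<Longrightarrow>
    exec K B (While t c) s x"
| While_None: "holds t s \<Longrightarrow> exec K B c s None \<Longrightarrow> exec K B (While t c) s None"


section \<open>Compilation to jump code\<close>

datatype instr = IFail | IRead | IOut bool | IInc nat | IDec nat | IBranch test nat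

fun code_size :: "com \<Rightarrow> nat" where
  "code_size Skip = 0"
| "code_size (c ;; d) = code_size c + code_size d"
| "code_size (If t c d) = code_size c + code_size d + 2"
| "code_size (While t c) = code_size c + 2"
| "code_size _ = 1"

text \<open>The second argument is the address at which the code is placed.\<close>

fun compile :: "com \<Rightarrow> nat \<Rightarrow> instr list" where
  "compile Skip a = []"
| "compile Fail a = [IFail]"
| "compile Read a = [IRead]"
| "compile (Out b) a = [IOut b]"
| "compile (Inc j) a = [IInc j]"
| "compile (Dec j) a = [IDec j]"
| "compile (c ;; d) a = compile c a @ compile d (a + code_size c)"
| "compile (If t c d) a = IBranch t (a + code_size c + 2) # compile c (a + 1) @
     IBranch Never (a + code_size c + code_size d + 2) # compile d (a + code_size c + 2)"
| "compile (While t c) a =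
     IBranch t (a + code_size c + 2) # compile c (a + 1) @ [IBranch Never a]"

lemma length_compile [simp]: "length (compile c a) = code_size c"
  by (induction c arbitrary: a) auto

text \<open>There are two halting addresses: \<open>length P\<close> for success and
  \<open>Suc (length P)\<close> for failure. The \<open>min\<close> keeps jumps away from the
  failure address.\<close>

fun istep :: "instr list \<Rightarrow> nat \<times> store \<Rightarrow> nat \<times> store" where
  "istep P (pc, r, u, C) =
    (if pc < length P then
       (case P ! pc of
          IFail \<Rightarrow> (Suc (length P), r, u, C)
        | IRead \<Rightarrow> (Suc pc, tl r, u, C)
        | IOut b \<Rightarrow> (Suc pc, r, u @ [b], C)
        | IInc j \<Rightarrow> (Suc pc, r, u, C(j := Suc (C j)))
        | IDec j \<Rightarrow> (Suc pc, r, u, C(j := C j - 1))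
        | IBranch t a \<Rightarrow> (if holds t (r, u, C) then Suc pc else min a (length P), r, u, C))
     else (pc, r, u, C))"

text \<open>Vanishing from \<open>K\<close> on means that the function \<open>C\<close> is
  determined by its first \<open>K\<close> values, for which there are finitely many choices, and
  that \<open>K\<close> counter tapes can represent it.\<close>

fun bounded :: "nat \<Rightarrow> nat \<Rightarrow> nat \<times> store \<Rightarrow> bool" where
  "bounded K B (pc, r, u, C) \<longleftrightarrow> (\<forall>j. C j \<le> B) \<and> (\<forall>j \<ge> K. C j = 0)"

text \<open>The bound is demanded along the whole run: the time estimate counts all visited
  configurations, and the simulation by a machine uses it before and after each step.\<close>

definition reach :: "nat \<Rightarrow> nat \<Rightarrow> instr list \<Rightarrow> nat \<times> store \<Rightarrow> nat \<times> store \<Rightarrow> bool" where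
  "reach K B P x y \<longleftrightarrow>
    (\<exists>t. (istep P ^^ t) x = y \<and> (\<forall>i \<le> t. bounded K B ((istep P ^^ i) x)))"

lemma reach_refl: "bounded K B x \<Longrightarrow> reach K B P x x"
  unfolding reach_def by (intro exI[of _ 0]) auto

lemma reach_bounded: "reach K B P x y \<Longrightarrow> bounded K B y"
  unfolding reach_def by blast

lemma reach_trans:
  assumes "reach K B P x y" "reach K B P y z"
  shows "reach K B P x z"
proof -
  obtain t where t: "(istep P ^^ t) x = y" "\<forall>i \<le> t. bounded K B ((istep P ^^ i) x)"
    using assms(1) unfolding reach_def by blast
  obtain t' where t': "(istep P ^^ t') y = z" "\<forall>i \<le> t'. bounded K B ((istep P ^^ i) y)"
    using assms(2) unfolding reach_def by blast
  have *: "(istep P ^^ (i + t)) x = (istep P ^^ i) y" for i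
    by (simp add: funpow_add t(1))
  have "bounded K B ((istep P ^^ i) x)" if "i \<le> t' + t" for i
  proof (cases "i \<le> t")
    case False
    then show ?thesis using t'(2) *[of "i - t"] that by simp
  qed (use t(2) in auto)
  then show ?thesis using *[of t'] t'(1) unfolding reach_def by blast
qed

lemma reach_step:
  assumes "bounded K B x" "istep P x = y" "bounded K B y"
  shows "reach K B P x y"
proof -
  have "bounded K B ((istep P ^^ i) x)" if "i \<le> Suc 0" for i
    using that assms by (cases i) auto
  then show ?thesis unfolding reach_def using assms(2) by (intro exI[of _ "Suc 0"]) auto
qed

lemma bounded_pc: "bounded K B (pc, s) \<Longrightarrow> bounded K B (pc', s)"
  by (cases s) auto

lemma istep_branch:
  assumes "P = xs @ IBranch t a # ys" "a \<le> length P"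
  shows "istep P (length xs, s) = (if holds t s then Suc (length xs) else a, s)"
  using assms by (cases s) auto

definition lands ::
    "nat \<Rightarrow> nat \<Rightarrow> instr list \<Rightarrow> nat \<times> store \<Rightarrow> nat \<Rightarrow> store option \<Rightarrow> bool" where
  "lands K B P y q x \<longleftrightarrow>
    (case x of Some s \<Rightarrow> reach K B P y (q, s) | None \<Rightarrow> \<exists>s. reach K B P y (Suc (length P), s))"

lemma lands_trans: "reach K B P y z \<Longrightarrow> lands K B P z q x \<Longrightarrow> lands K B P y q x"
  unfolding lands_def by (cases x) (simp_all, blast intro: reach_trans, blast intro: reach_trans)

text \<open>Serves for the jump over the else branch. A failed run has halted elsewhere: for
  \<open>None\<close> the address \<open>q\<close> does not enter \<open>lands\<close>.\<close>

lemma lands_step: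
  assumes "lands K B P y q x" "\<And>s. istep P (q, s) = (q', s)"
  shows "lands K B P y q' x"
proof (cases x)
  case (Some s)
  then have y: "reach K B P y (q, s)" using assms(1) by (simp add: lands_def)
  have q: "bounded K B (q, s)" using reach_bounded[OF y] .
  have "reach K B P (q, s) (q', s)" by (rule reach_step[OF q assms(2) bounded_pc[OF q]])
  then show ?thesis using reach_trans[OF y] Some by (simp add: lands_def)
qed (use assms(1) in \<open>simp add: lands_def\<close>)

lemma reach_branch:
  assumes "P = xs @ IBranch t a # ys" "a \<le> length P" "bounded K B (0, s)"
  shows "reach K B P (length xs, s) (if holds t s then Suc (length xs) else a, s)"
  using bounded_pc[OF assms(3)] istep_branch[OF assms(1, 2)] bounded_pc[OF assms(3)]
  by (rule reach_step)

text \<open>The induction is on the derivation, not on the command, since the derivation of a loop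
  contains another one of the same loop. The surrounding code \<open>xs\<close>, \<open>ys\<close>
  varies because a subcommand sits deeper inside the fixed \<open>P\<close>.\<close>

lemma compile_correct:
  assumes "exec K B c s x" "P = xs @ compile c (length xs) @ ys" "bounded K B (0, s)"
  shows "lands K B P (length xs, s) (length xs + code_size c) x"
  using assms
proof (induction arbitrary: xs ys)
  case (Skip s)
  then show ?case by (simp add: lands_def reach_refl bounded_pc)
next
  case (Fail s)
  then show ?case
    by (cases s) (simp add: lands_def, intro exI, rule reach_step; simp)
next
  case (Read b r u C)
  then show ?case by (simp add: lands_def) (rule reach_step; simp)
next
  case (Out b r u C)
  then show ?case by (simp add: lands_def) (rule reach_step; simp)
next
  case (Inc j C r u)
  then show ?case by (simp add: lands_def) (rule reach_step; auto)
next
  case (Dec j r u C)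
  then show ?case
    by (simp add: lands_def) (rule reach_step; simp add: le_diff_conv le_SucI)
next
  case (Seq c s s' d x)
  let ?xs = "xs @ compile c (length xs)"
  have "P = xs @ compile c (length xs) @ compile d (length xs + code_size c) @ ys"
    using Seq.prems(1) by simp
  from Seq.IH(1)[OF this Seq.prems(2)]
  have 1: "reach K B P (length xs, s) (length ?xs, s')"
    by (simp add: lands_def)
  have "P = ?xs @ compile d (length ?xs) @ ys"
    using Seq.prems(1) by simp
  from Seq.IH(2)[OF this bounded_pc[OF reach_bounded[OF 1]]]
  show ?case
    using lands_trans[OF 1] by (simp add: add.assoc)
next
  case (Seq_None c s d)
  have "P = xs @ compile c (length xs) @ compile d (length xs + code_size c) @ ys"
    using Seq_None.prems(1) by simp
  from Seq_None.IH[OF this Seq_None.prems(2)] show ?case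
    by (simp add: lands_def)
next
  case (If_True t s c x d)
  let ?e = "length xs + code_size c + code_size d + 2"
  let ?xs = "xs @ [IBranch t (length xs + code_size c + 2)]"
  let ?ys = "IBranch Never ?e # compile d (length xs + code_size c + 2) @ ys"
  have P: "P = ?xs @ compile c (length ?xs) @ ?ys"
    using If_True.prems by simp
  have "P = xs @ IBranch t (length xs + code_size c + 2) # compile c (length ?xs) @ ?ys"
    using P by simp
  from reach_branch[OF this _ If_True.prems(2)] P
  have 1: "reach K B P (length xs, s) (length ?xs, s)"
    using If_True.hyps by simp
  have "P = (?xs @ compile c (length ?xs)) @ ?ys" using P by simp
  from istep_branch[OF this]
  have "istep P (length ?xs + code_size c, s') = (?e, s')" for s'
    using P by simp
  from lands_step[OF lands_trans[OF 1 If_True.IH[OF P If_True.prems(2)]] this]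
  show ?case by (simp add: add.assoc)
next
  case (If_False t s d x c)
  let ?e = "length xs + code_size c + code_size d + 2"
  let ?xs = "xs @ IBranch t (length xs + code_size c + 2) # compile c (length xs + 1) @
    [IBranch Never ?e]"
  have P: "P = ?xs @ compile d (length ?xs) @ ys"
    using If_False.prems by simp
  have "P = xs @ IBranch t (length xs + code_size c + 2) # compile c (length xs + 1) @
      IBranch Never ?e # compile d (length ?xs) @ ys"
    using P by simp
  from reach_branch[OF this _ If_False.prems(2)] P
  have 1: "reach K B P (length xs, s) (length ?xs, s)"
    using If_False.hyps by simp
  from lands_trans[OF 1 If_False.IH[OF P If_False.prems(2)]]
  show ?case by (simp add: add_ac)
next
  case (While_False t s c)
  have "P = xs @ IBranch t (length xs + code_size c + 2) # compile c (length xs + 1) @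
      IBranch Never (length xs) # ys"
    using While_False.prems by simp
  from reach_branch[OF this _ While_False.prems(2)] this show ?case
    using While_False.hyps by (simp add: lands_def)
next
  case (While_True t s c s' x)
  let ?xs = "xs @ [IBranch t (length xs + code_size c + 2)]"
  let ?ys = "IBranch Never (length xs) # ys"
  have P: "P = ?xs @ compile c (length ?xs) @ ?ys"
    using While_True.prems by simp
  have "P = xs @ IBranch t (length xs + code_size c + 2) # compile c (length ?xs) @ ?ys"
    using P by simp
  from reach_branch[OF this _ While_True.prems(2)] P
  have 1: "reach K B P (length xs, s) (length ?xs, s)"
    using While_True.hyps by simp
  have 2: "reach K B P (length ?xs, s) (length (?xs @ compile c (length ?xs)), s')"
    using While_True.IH(1)[OF P While_True.prems(2)] by (simp add: lands_def)
  have "P = (?xs @ compile c (length ?xs)) @ ?ys" using P by simp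
  from reach_branch[OF this _ bounded_pc[OF reach_bounded[OF 2]]] P
  have 3: "reach K B P (length (?xs @ compile c (length ?xs)), s') (length xs, s')"
    by simp
  have "bounded K B (0, s')" by (rule bounded_pc[OF reach_bounded[OF 2]])
  from lands_trans[OF reach_trans[OF 1 reach_trans[OF 2 3]]
    While_True.IH(2)[OF While_True.prems(1) this]]
  show ?case .
next
  case (While_None t s c)
  let ?xs = "xs @ [IBranch t (length xs + code_size c + 2)]"
  let ?ys = "IBranch Never (length xs) # ys"
  have P: "P = ?xs @ compile c (length ?xs) @ ?ys"
    using While_None.prems by simp
  have "P = xs @ IBranch t (length xs + code_size c + 2) # compile c (length ?xs) @ ?ys"
    using P by simp
  from reach_branch[OF this _ While_None.prems(2)] P
  have 1: "reach K B P (length xs, s) (length ?xs, s)"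
    using While_None.hyps by simp
  from lands_trans[OF 1 While_None.IH[OF P While_None.prems(2)]]
  show ?case by (simp add: lands_def)
qed


section \<open>A bound on the running time\<close>

text \<open>The output is dropped: no instruction inspects it, so it cannot influence the run, and
  it is the one component that keeps growing.\<close>

fun key :: "nat \<times> store \<Rightarrow> nat \<times> bool list \<times> (nat \<Rightarrow> nat)" where
  "key (pc, r, u, C) = (pc, r, C)"

lemma holds_key: "holds t (r, u, C) = holds t (r, u', C)"
  by (induction t) auto

lemma key_istep:
  assumes "key x = key y"
  shows "key (istep P x) = key (istep P y)"
proof -
  obtain pc r u C u' where x: "x = (pc, r, u, C)" and y: "y = (pc, r, u', C)"
    using assms by (cases x; cases y) auto
  have "holds t (r, u, C) = holds t (r, u', C)" for t
    by (rule holds_key)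
  then show ?thesis unfolding x y by (auto split: instr.splits)
qed

lemma key_funpow: "key x = key y \<Longrightarrow> key ((istep P ^^ n) x) = key ((istep P ^^ n) y)"
  by (induction n) (auto intro: key_istep)

lemma fst_key: "fst (key x) = fst x"
  by (cases x) auto

lemma istep_halted: "length P \<le> fst x \<Longrightarrow> istep P x = x"
  by (cases x) auto

lemma funpow_halted: "length P \<le> fst x \<Longrightarrow> (istep P ^^ n) x = x"
  by (induction n) (auto simp: istep_halted)

lemma istep_input_suffix: "\<exists>n. fst (snd (istep P x)) = drop n (fst (snd x))"
  by (cases x) (auto split: instr.splits intro: exI[of _ 0] exI[of _ 1] simp: drop_Suc)

lemma funpow_input_suffix: "\<exists>n. fst (snd ((istep P ^^ t) x)) = drop n (fst (snd x))"
proof (induction t)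
  case 0
  then show ?case by (auto intro: exI[of _ 0])
next
  case (Suc t)
  then show ?case using istep_input_suffix[of P "(istep P ^^ t) x"] by (auto simp: drop_drop)
qed

lemma funpow_output_length:
  "length (fst (snd (snd ((istep P ^^ t) x)))) \<le> length (fst (snd (snd x))) + t"
proof (induction t)
  case (Suc t)
  have "length (fst (snd (snd (istep P y)))) \<le> Suc (length (fst (snd (snd y))))" for y
    by (cases y) (auto split: instr.splits)
  from this[of "(istep P ^^ t) x"] Suc show ?case by simp
qed auto

text \<open>Before halting, no triple of program counter, remaining input and counters can recur.\<close>

lemma reach_halt_time:
  assumes "reach K B P x y" "length P \<le> fst y"
  defines "w \<equiv> fst (snd x)"
  shows "\<exists>t \<le> length P * (Suc (length w) * Suc B ^ K).
    (istep P ^^ t) x = y \<and> (\<forall>i \<le> t. bounded K B ((istep P ^^ i) x))"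
proof -
  obtain t where t: "(istep P ^^ t) x = y" "\<forall>i \<le> t. bounded K B ((istep P ^^ i) x)"
    using assms(1) unfolding reach_def by blast
  define h where "h = (LEAST t. length P \<le> fst ((istep P ^^ t) x))"
  have h: "length P \<le> fst ((istep P ^^ h) x)"
    unfolding h_def by (rule LeastI[of _ t]) (use t assms in simp)
  have less: "fst ((istep P ^^ i) x) < length P" if "i < h" for i
    using not_less_Least that h_def by (metis not_le)
  have "h \<le> t" unfolding h_def by (rule Least_le) (use t assms in simp)
  then have "(istep P ^^ t) x = (istep P ^^ (t - h)) ((istep P ^^ h) x)"
    by (simp flip: funpow_add[THEN fun_cong, unfolded comp_def])
  then have hy: "(istep P ^^ h) x = y"
    using funpow_halted[OF h] t by simp
  \<comment> \<open>The remaining input is a suffix of \<open>w\<close>, hence given by its length,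
    and the counters from \<open>K\<close> on are 0. So \<open>F\<close> carries the same
    information as the key but has values in a finite set whose size is the claimed bound.\<close>
  define F where "F i = (case key ((istep P ^^ i) x) of (pc, r, C) \<Rightarrow>
      (pc, length r, map C [0..<K]))" for i
  let ?T = "{..<length P} \<times> {..length w} \<times> {xs. set xs \<subseteq> {..B} \<and> length xs = K}"
  have bd: "bounded K B ((istep P ^^ i) x)" if "i < h" for i
    using t that \<open>h \<le> t\<close> by simp
  have range: "F ` {..<h} \<subseteq> ?T"
  proof (intro image_subsetI)
    fix i assume i: "i \<in> {..<h}"
    obtain pc r u C where s: "(istep P ^^ i) x = (pc, r, u, C)" by (cases "(istep P ^^ i) x") auto
    obtain n where "r = drop n w" using funpow_input_suffix[of t P x] s w_def
      by (metis fst_conv funpow_input_suffix snd_conv)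
    then show "F i \<in> ?T" using less[of i] bd[of i] i s by (auto simp: F_def)
  qed
  have inj: "inj_on F {..<h}"
  proof -
    have False if "i < j" "j < h" "F i = F j" for i j
    proof -
      obtain pc r u C where s: "(istep P ^^ i) x = (pc, r, u, C)"
        by (cases "(istep P ^^ i) x") auto
      obtain pc' r' u' C' where s': "(istep P ^^ j) x = (pc', r', u', C')"
        by (cases "(istep P ^^ j) x") auto
      obtain n n' where "r = drop n w" "r' = drop n' w"
        using funpow_input_suffix[of i P x] funpow_input_suffix[of j P x] s s' w_def by auto
      moreover have "length r = length r'" using that s s' by (simp add: F_def)
      ultimately have "r = r'" by (metis append_take_drop_id append_eq_append_conv)
      moreover have "C = C'"
      proof
        fix l
        show "C l = C' l"
        proof (cases "l < K")
          case True
          then show ?thesis using that s s' by (simp add: F_def)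
        next
          case False
          then show ?thesis using bd[of i] bd[of j] that s s' by simp
        qed
      qed
      ultimately have "key ((istep P ^^ i) x) = key ((istep P ^^ j) x)"
        using that s s' by (simp add: F_def)
      \<comment> \<open>After \<open>h - j\<close> more steps the later configuration has halted.
        Equal keys evolve equally, so the earlier one has halted too, at time
        \<open>h - j + i < h\<close>, against the minimality of \<open>h\<close>.\<close>
      then have "key ((istep P ^^ (h - j + i)) x) = key ((istep P ^^ (h - j + j)) x)"
        unfolding funpow_add comp_def by (rule key_funpow)
      then have "length P \<le> fst ((istep P ^^ (h - j + i)) x)"
        using h that by (metis fst_key less_imp_le_nat le_add_diff_inverse2)
      moreover have "h - j + i < h" using that by simp
      ultimately show False using less not_le by blast
    qed
    then show ?thesis
      by (intro inj_onI) (metis lessThan_iff linorder_neqE_nat)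
  qed
  have fin: "finite {xs :: nat list. set xs \<subseteq> {..B} \<and> length xs = K}"
    by (rule finite_lists_length_eq) simp
  have "h = card (F ` {..<h})" using card_image[OF inj] by simp
  also have "\<dots> \<le> card ?T" by (intro card_mono range finite_cartesian_product fin) auto
  also have "\<dots> = length P * (Suc (length w) * Suc B ^ K)"
    by (simp add: card_cartesian_product card_lists_length_eq)
  finally show ?thesis using hy t \<open>h \<le> t\<close> by (intro exI[of _ h]) auto
qed

section \<open>Turing machines for compiled programs\<close>

definition sym :: "bool \<Rightarrow> nat" where
  "sym b = (if b then 2 else 1)"

definition keep :: "nat list \<Rightarrow> (nat \<times> move) list" where
  "keep rs = map (\<lambda>a. (a, Stay)) rs"

text \<open>
  Counter \<open>j\<close> is the head position on tape \<open>j + 2\<close>, which is blank except for a marker \<open>1\<close> in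
  cell \<open>0\<close>.
\<close>

fun scan_holds :: "test \<Rightarrow> nat list \<Rightarrow> bool" where
  "scan_holds Never rs = False"
| "scan_holds (Sees x) rs = ((if rs ! 0 = 0 then None else Some (rs ! 0 = 2)) = x)"
| "scan_holds (Pos j) rs = (j + 2 < length rs \<and> rs ! (j + 2) = 0)"
| "scan_holds (And t t') rs = (scan_holds t rs \<and> scan_holds t' rs)"

text \<open>The input head stops at the first blank and a counter head at its marker, mirroring
  \<open>tl [] = []\<close> and truncated subtraction. An update for a counter without a tape lies
  beyond the end of the list and changes nothing.\<close>

fun instr_delta :: "nat \<Rightarrow> instr \<Rightarrow> nat \<Rightarrow> nat list \<Rightarrow> nat \<times> (nat \<times> move) list" where
  "instr_delta L IFail q rs = (L + 2, keep rs)"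
| "instr_delta L IRead q rs =
    (q + 1, (keep rs)[0 := (rs ! 0, if rs ! 0 = 0 then Stay else MoveRight)])"
| "instr_delta L (IOut b) q rs = (q + 1, (keep rs)[1 := (sym b, MoveRight)])"
| "instr_delta L (IInc j) q rs = (q + 1, (keep rs)[j + 2 := (rs ! (j + 2), MoveRight)])"
| "instr_delta L (IDec j) q rs =
    (q + 1, (keep rs)[j + 2 := (rs ! (j + 2), if rs ! (j + 2) = 1 then Stay else MoveLeft)])"
| "instr_delta L (IBranch t a) q rs = (if scan_holds t rs then q + 1 else min a L + 1, keep rs)"

text \<open>
  State \<open>0\<close> writes the markers and state \<open>pc + 1\<close> executes instruction \<open>pc\<close> of the code, which
  has length \<open>L\<close>. State \<open>L + 2\<close> is entered on failure and erases the output, state \<open>L + 1\<close> on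
  success; from there the input is erased and the output is moved to the first tape.
\<close>

definition program_delta :: "instr list \<Rightarrow> nat \<Rightarrow> nat list \<Rightarrow> nat \<times> (nat \<times> move) list" where
  "program_delta P q rs = (let L = length P; a = rs ! 0; b = rs ! 1 in
    if q = 0 then (1, (a, Stay) # (b, Stay) # map (\<lambda>_. (1, Stay)) (drop 2 rs))
    else if q \<le> L then instr_delta L (P ! (q - 1)) q rs
    else if q = L + 1 then
      if a \<noteq> 0 then (L + 1, (keep rs)[0 := (a, MoveRight)])
      else (L + 4, (keep rs)[0 := (a, MoveLeft)])
    else if q = L + 2 then (L + 3, (keep rs)[1 := (b, MoveLeft)])
    else if q = L + 3 then
      if b \<noteq> 0 then (L + 3, (keep rs)[1 := (0, MoveLeft)])
      else (L + 1, (keep rs)[1 := (0, MoveRight)])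
    else if q = L + 4 then
      if a \<noteq> 0 then (L + 4, (keep rs)[0 := (0, MoveLeft)])
      else (L + 5, (keep rs)[0 := (0, MoveRight), 1 := (b, MoveLeft)])
    else if q = L + 5 then
      if b \<noteq> 0 then (L + 5, (keep rs)[1 := (b, MoveLeft)])
      else (L + 6, (keep rs)[1 := (b, MoveRight)])
    else if b \<noteq> 0 then (L + 6, (keep rs)[0 := (b, MoveRight), 1 := (b, MoveRight)])
    else (L + 7, keep rs))"

definition machine :: "nat \<Rightarrow> instr list \<Rightarrow> tm" where
  "machine K P =
    \<lparr>tapes = K + 2, symbols = 3, states = length P + 7, delta = program_delta P\<rparr>"

section \<open>Well-formedness of the machine\<close>

lemma length_keep [simp]: "length (keep rs) = length rs"
  by (simp add: keep_def)

lemma act_Stay: "act (scan t, Stay) t = t"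
  by (cases t) simp

lemma map2_act_keep: "map2 act (keep (map scan ts)) ts = ts"
  by (induction ts) (auto simp: keep_def act_Stay)

lemma map2_act_update:
  "map2 act (xs[i := x]) ts = (map2 act xs ts)[i := act x (ts ! i)]"
proof (induction xs arbitrary: i ts)
  case (Cons y xs)
  then show ?case by (cases ts; cases i) auto
qed auto

lemma set_keep_update:
  assumes "set rs \<subseteq> {..<3}" "i < length rs \<Longrightarrow> fst x < 3"
  shows "fst ` set ((keep rs)[i := x]) \<subseteq> {..<3}"
proof (cases "i < length rs")
  case True
  have "set ((keep rs)[i := x]) \<subseteq> insert x (set (keep rs))"
    by (rule set_update_subset_insert)
  then have "fst ` set ((keep rs)[i := x]) \<subseteq> insert (fst x) (set rs)"
    by (auto simp: keep_def)
  then show ?thesis using assms True by auto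
next
  case False
  then show ?thesis using assms by (auto simp: keep_def list_update_beyond)
qed

lemma keep_update2: "(keep rs)[0 := x, 1 := y] = x # y # keep (drop 2 rs)" if "2 \<le> length rs"
  using that by (cases rs; cases "tl rs") (auto simp: keep_def)

lemma nth_less3: "set rs \<subseteq> {..<3 :: nat} \<Longrightarrow> i < length rs \<Longrightarrow> rs ! i < 3"
  using nth_mem by fastforce

lemma wf_machine: "wf_tm (machine K P)"
proof -
  have *: "case program_delta P q rs of (q', as) \<Rightarrow>
      q' \<le> length P + 7 \<and> length as = K + 2 \<and> fst ` set as \<subseteq> {..<3}"
    if q: "q < length P + 7" and rs: "length rs = K + 2" "set rs \<subseteq> {..<3}" for q rs
  proof -
    have ab: "rs ! 0 < 3" "rs ! 1 < 3" using nth_less3[OF rs(2)] rs(1) by auto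
    have k: "fst ` set (keep rs) \<subseteq> {..<3}" using rs(2) by (auto simp: keep_def)
    have u: "fst ` set ((keep rs)[i := (rs ! i, m)]) \<subseteq> {..<3}" for i m
      using set_keep_update[OF rs(2), of i "(rs ! i, m)"] nth_less3[OF rs(2)] by simp
    have u': "fst ` set ((keep rs)[i := (a, m)]) \<subseteq> {..<3}" if "a < 3" for i a m
      using set_keep_update[OF rs(2), of i "(a, m)"] that by simp
    have u2: "fst ` set ((keep rs)[0 := (a, m), 1 := (b, n)]) \<subseteq> {..<3}" if "a < 3" "b < 3"
      for a b m n
      using rs that by (subst keep_update2) (auto simp: keep_def dest: in_set_dropD)
    have i: "case instr_delta (length P) I q rs of (q', as) \<Rightarrow>
        q' \<le> length P + 7 \<and> length as = K + 2 \<and> fst ` set as \<subseteq> {..<3}"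
      if "q \<le> length P" for I
      using that k u u' rs by (cases I) (auto simp: sym_def)
    show ?thesis
    proof (cases "q = 0 \<or> length P < q")
      case False
      then show ?thesis using i[of "P ! (q - 1)"] by (simp add: program_delta_def Let_def)
    next
      case True
      then show ?thesis using q rs ab k u'[OF ab(1)] u'[OF ab(2)] u'[of 0] u2[of 0] u2[OF ab(2, 2)] ab
        by (auto simp: program_delta_def Let_def)
    qed
  qed
  show ?thesis
    unfolding wf_tm_def machine_def using * by simp
qed

subsection \<open>Tape contents\<close>

lemma contents_Nil: "contents [] = (\<lambda>_. 0)"
  by (simp add: contents_def fun_eq_iff)

lemma contents_length [simp]: "contents w (int (length w)) = 0"
  by (simp add: contents_def)

lemma contents_negative: "i < 0 \<Longrightarrow> contents w i = 0"
  by (simp add: contents_def)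

lemma contents_nth: "i < length w \<Longrightarrow> contents w (int i) = sym (w ! i)"
  by (simp add: contents_def sym_def)

lemma sym_pos: "0 < sym b"
  by (simp add: sym_def)

lemma contents_snoc: "(contents w)(int (length w) := sym b) = contents (w @ [b])"
  by (auto simp: contents_def sym_def fun_eq_iff nth_append nat_less_iff)

lemma contents_take_Suc:
  "i < length w \<Longrightarrow> (contents (take i w))(int i := sym (w ! i)) = contents (take (Suc i) w)"
  using contents_snoc[of "take i w" "w ! i"] by (simp add: take_Suc_conv_app_nth)

lemma contents_take_erase:
  "i < length w \<Longrightarrow> (contents (take (Suc i) w))(int i := 0) = contents (take i w)"
  by (auto simp: contents_def fun_eq_iff nat_less_iff)

lemma contents_drop:
  assumes "r = drop n w"
  shows "contents w (int (length w - length r)) = (case r of [] \<Rightarrow> 0 | b # _ \<Rightarrow> sym b)"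
proof (cases r)
  case (Cons b r')
  then have n: "n < length w" using assms by (metis drop_eq_Nil2 list.simps(3) not_le)
  then have "length w - length r = n" "w ! n = b"
    using assms Cons hd_drop_conv_nth[OF n] by (simp, metis list.sel(1))
  then show ?thesis using contents_nth[OF n] Cons by simp
qed simp

subsection \<open>Simulation\<close>

text \<open>The input head is placed by the length of the rest \<open>r\<close>, which is always a
  suffix of \<open>w\<close>. The shift to \<open>Suc pc\<close> leaves state 0 for the
  initialization and sends the two halting addresses to the states \<open>L + 1\<close> and
  \<open>L + 2\<close> in which the final phase begins.\<close>

definition tape_config :: "nat \<Rightarrow> bool list \<Rightarrow> nat \<times> store \<Rightarrow> config" where
  "tape_config K w x = (case x of (pc, r, u, C) \<Rightarrow>
    (Suc pc, (contents w, int (length w - length r)) # (contents u, int (length u)) #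
      map (\<lambda>j. (contents [False], int (C j))) [0..<K]))"

declare step.simps [simp del]

lemma step_machine:
  "q \<noteq> length P + 7 \<Longrightarrow> step (machine K P) (q, ts) =
    (case program_delta P q (map scan ts) of (q', as) \<Rightarrow> (q', map2 act as ts))"
  by (simp add: machine_def step.simps)

lemma program_delta_instr:
  "pc < length P \<Longrightarrow> program_delta P (Suc pc) rs = instr_delta (length P) (P ! pc) (Suc pc) rs"
  by (simp add: program_delta_def Let_def)

lemma scan_marker: "contents [False] (int n) = (if n = 0 then 1 else 0)"
  by (simp add: contents_def)

text \<open>A counter without a tape tests as zero on the machine. The program agrees because
  bounded configurations have 0 in all those counters.\<close>

lemma scan_holds_iff:
  assumes "r = drop n w" "\<forall>j \<ge> K. C j = 0"
  shows "scan_holds t (contents w (int (length w - length r)) # a #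
    map (\<lambda>j. contents [False] (int (C j))) [0..<K]) = holds t (r, u, C)"
proof (induction t)
  case (Sees x)
  show ?case
    using contents_drop[OF assms(1)] by (cases r) (auto simp: sym_def)
next
  case (Pos j)
  show ?case
  proof (cases "j < K")
    case True
    then show ?thesis by (simp add: scan_marker)
  next
    case False
    then show ?thesis using assms(2) by simp
  qed
qed auto

lemma counter_tapes_update:
  "j < K \<Longrightarrow> (map (\<lambda>j. (c, int (C j))) [0..<K])[j := (c, int n)] =
    map (\<lambda>i. (c, int ((C(j := n)) i))) [0..<K]"
  by (rule nth_equalityI) (auto simp: nth_list_update)

lemma simulate_step:
  assumes "bounded K B x" "bounded K B (istep P x)" "fst x < length P" "fst (snd x) = drop n w"
  shows "step (machine K P) (tape_config K w x) = tape_config K w (istep P x)"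
proof -
  obtain pc r u C where x: "x = (pc, r, u, C)" by (cases x)
  have pc: "pc < length P" and r: "r = drop n w" using assms x by auto
  have C: "\<forall>j \<ge> K. C j = 0" using assms x by auto
  let ?ts = "(contents w, int (length w - length r)) # (contents u, int (length u)) #
      map (\<lambda>j. (contents [False], int (C j))) [0..<K]"
  let ?rs = "map scan ?ts"
  have rs: "?rs = contents w (int (length w - length r)) # 0 #
      map (\<lambda>j. contents [False] (int (C j))) [0..<K]"
    by simp
  have st: "step (machine K P) (tape_config K w x) =
      (case instr_delta (length P) (P ! pc) (Suc pc) ?rs of (q', as) \<Rightarrow> (q', map2 act as ?ts))"
    using pc by (simp only: tape_config_def x prod.case) (simp add: step_machine program_delta_instr)
  have keep: "map2 act (keep ?rs) ?ts = ?ts" by (rule map2_act_keep)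
  have upd: "map2 act ((keep ?rs)[i := y]) ?ts = ?ts[i := act y (?ts ! i)]" for i y
    by (simp only: map2_act_update keep)
  show ?thesis
  proof (cases "P ! pc")
    case IFail
    then show ?thesis unfolding st IFail instr_delta.simps prod.case keep
      using pc IFail by (simp add: x tape_config_def)
  next
    case IRead
    define h where "h = length w - length r"
    have h: "contents w (int h) = (case r of [] \<Rightarrow> 0 | b # _ \<Rightarrow> sym b)"
      unfolding h_def by (rule contents_drop[OF r])
    show ?thesis
    proof (cases r)
      case Nil
      then show ?thesis unfolding st IRead instr_delta.simps prod.case upd
        using pc IRead by (simp add: x tape_config_def fun_upd_idem)
    next
      case (Cons b r')
      have "length r \<le> length w" using r by simp
      then have "length w - length r' = Suc h" using Cons by (simp add: h_def)
      then show ?thesis unfolding st IRead instr_delta.simps prod.case upd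
        unfolding h_def[symmetric]
        using pc IRead h sym_pos[of b] Cons
        by (simp add: x tape_config_def h_def[symmetric] fun_upd_idem add.commute)
    qed
  next
    case (IOut b)
    then show ?thesis unfolding st IOut instr_delta.simps prod.case upd
      using pc IOut by (simp add: x tape_config_def contents_snoc add.commute)
  next
    case (IInc j)
    \<comment> \<open>The bound on the configuration after the step is what excludes incrementing a
      counter that has no tape.\<close>
    have "(C(j := Suc (C j))) j = 0" if "K \<le> j"
      using assms(2) pc IInc that by (simp add: x del: fun_upd_apply)
    then have j: "j < K" by (metis fun_upd_same nat.distinct(2) not_le)
    show ?thesis unfolding st IInc instr_delta.simps prod.case upd
      using pc IInc j counter_tapes_update[OF j, of "contents [False]" C "Suc (C j)"]
      by (simp add: x tape_config_def add.commute)
  next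
    case (IDec j)
    show ?thesis
    proof (cases "j < K")
      case True
      then show ?thesis unfolding st IDec instr_delta.simps prod.case upd
        using pc IDec True counter_tapes_update[OF True, of "contents [False]" C "C j - 1"]
          scan_marker[of "C j"]
        by (cases "C j") (simp_all add: x tape_config_def fun_upd_idem)
    next
      case False
      then have "C(j := C j - 1) = C" using C by auto
      then show ?thesis unfolding st IDec instr_delta.simps prod.case upd
        using pc IDec False by (simp add: x tape_config_def list_update_beyond)
    qed
  next
    case (IBranch t a)
    show ?thesis unfolding st IBranch instr_delta.simps prod.case keep
      using pc IBranch unfolding rs scan_holds_iff[OF r C, of t 0 u] by (simp add: x tape_config_def)
  qed
qed

lemma simulate_steps:
  assumes "\<forall>i \<le> t. bounded K B ((istep P ^^ i) (0, w, [], \<lambda>_. 0))"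
    "\<forall>i < t. fst ((istep P ^^ i) (0, w, [], \<lambda>_. 0)) < length P"
  shows "(step (machine K P) ^^ t) (tape_config K w (0, w, [], \<lambda>_. 0)) =
    tape_config K w ((istep P ^^ t) (0, w, [], \<lambda>_. 0))"
  using assms
proof (induction t)
  case (Suc t)
  let ?x = "(istep P ^^ t) (0, w, [], \<lambda>_. 0)"
  obtain n where "fst (snd ?x) = drop n w"
    using funpow_input_suffix[of t P "(0, w, [], \<lambda>_. 0)"] by auto
  then have "step (machine K P) (tape_config K w ?x) = tape_config K w (istep P ?x)"
    using Suc.prems by (intro simulate_step[where B = B]) (auto dest: spec[of _ "Suc t"] spec[of _ t])
  with Suc show ?case by simp
qed simp

lemma initial_step:
  "step (machine K P) (start_config (machine K P) w) = tape_config K w (0, w, [], \<lambda>_. 0)"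
proof -
  have "contents [] (0 :: int) = 0" "(contents [])(0 := Suc 0) = contents [False]"
    by (auto simp: contents_def fun_eq_iff)
  then have "act (1, Stay) (contents [], 0) = (contents [False], 0)" by simp
  then have *: "map2 act (replicate K (1, Stay)) (replicate K (contents [], 0)) =
      map (\<lambda>j. (contents [False], 0)) [0..<K]"
    by (simp add: zip_replicate map_replicate_const)
  have "start_config (machine K P) w =
      (0, (contents w, 0) # (contents [], 0) # replicate K (contents [], 0))"
    by (simp add: start_config_def machine_def)
  then show ?thesis
    using * by (simp add: step_machine program_delta_def Let_def tape_config_def map_replicate_const)
qed

subsection \<open>Moving the output to the first tape\<close>

text \<open>A program may stop with input unread, so the head first moves past the right end; the
  erasure on the way back then meets every input symbol. The summand 1 is the step made on the
  blank.\<close>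

lemma scan_input_right:
  "i \<le> length w \<Longrightarrow> (step (machine K P) ^^ (length w - i + 1))
     (length P + 1, (contents w, int i) # T # ts) =
   (length P + 4, (contents w, int (length w) - 1) # T # ts)"
proof (induction "length w - i" arbitrary: i)
  case 0
  then have "i = length w" by simp
  then show ?case
    using map2_act_keep[of ts]
    by (simp add: step_machine program_delta_def Let_def keep_def act_Stay fun_upd_idem)
next
  case (Suc n)
  then have i: "i < length w" and n: "length w - i + 1 = Suc (length w - Suc i + 1)" by auto
  have "step (machine K P) (length P + 1, (contents w, int i) # T # ts) =
      (length P + 1, (contents w, int (Suc i)) # T # ts)"
    using i map2_act_keep[of ts]
    by (simp add: step_machine program_delta_def Let_def keep_def act_Stay contents_nth
        sym_pos[THEN less_imp_neq, symmetric] add.commute fun_upd_idem)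
  then show ?case
    using Suc(1)[of "Suc i"] Suc(2) i unfolding n funpow_Suc_right comp_def by simp
qed

lemma erase_input:
  "i \<le> length w \<Longrightarrow> (step (machine K P) ^^ (i + 1))
     (length P + 4, (contents (take i w), int i - 1) # (c, h) # ts) =
   (length P + 5, (contents [], 0) # (c, h - 1) # ts)"
proof (induction i)
  case 0
  then show ?case
    using map2_act_keep[of ts]
    by (simp add: step_machine program_delta_def Let_def keep_def contents_Nil fun_upd_idem)
next
  case (Suc i)
  have "step (machine K P) (length P + 4, (contents (take (Suc i) w), int i) # (c, h) # ts) =
      (length P + 4, (contents (take i w), int i - 1) # (c, h) # ts)"
    using Suc.prems map2_act_keep[of ts] contents_nth[of i "take (Suc i) w"]
    by (simp add: step_machine program_delta_def Let_def keep_def contents_take_erase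
        sym_pos[THEN less_imp_neq, symmetric] fun_upd_idem)
  then show ?case
    using Suc by (simp add: funpow_Suc_right del: funpow.simps)
qed

lemma erase_output:
  "i \<le> length u \<Longrightarrow> (step (machine K P) ^^ (i + 1))
     (length P + 3, T # (contents (take i u), int i - 1) # ts) =
   (length P + 1, T # (contents [], 0) # ts)"
proof (induction i)
  case 0
  then show ?case
    using map2_act_keep[of ts]
    by (simp add: step_machine program_delta_def Let_def keep_def contents_Nil fun_upd_idem act_Stay)
next
  case (Suc i)
  have "step (machine K P) (length P + 3, T # (contents (take (Suc i) u), int i) # ts) =
      (length P + 3, T # (contents (take i u), int i - 1) # ts)"
    using Suc.prems map2_act_keep[of ts] contents_nth[of i "take (Suc i) u"]
    by (simp add: step_machine program_delta_def Let_def keep_def contents_take_erase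
        sym_pos[THEN less_imp_neq, symmetric] act_Stay)
  then show ?case
    using Suc by (simp add: funpow_Suc_right del: funpow.simps)
qed

lemma rewind_output:
  "i \<le> length u \<Longrightarrow> (step (machine K P) ^^ (i + 1))
     (length P + 5, T # (contents u, int i - 1) # ts) =
   (length P + 6, T # (contents u, 0) # ts)"
proof (induction i)
  case 0
  then show ?case
    using map2_act_keep[of ts] contents_negative[of "-1" u]
    by (simp add: step_machine program_delta_def Let_def keep_def fun_upd_idem act_Stay)
next
  case (Suc i)
  have "step (machine K P) (length P + 5, T # (contents u, int i) # ts) =
      (length P + 5, T # (contents u, int i - 1) # ts)"
    using Suc.prems map2_act_keep[of ts] contents_nth[of i u]
    by (simp add: step_machine program_delta_def Let_def keep_def
        sym_pos[THEN less_imp_neq, symmetric] act_Stay fun_upd_idem)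
  then show ?case
    using Suc by (simp add: funpow_Suc_right del: funpow.simps)
qed

lemma copy_output:
  "i \<le> length u \<Longrightarrow> \<exists>ts'. (step (machine K P) ^^ (length u - i + 1))
     (length P + 6, (contents (take i u), int i) # (contents u, int i) # ts) =
   (length P + 7, (contents u, int (length u)) # ts')"
proof (induction "length u - i" arbitrary: i)
  case 0
  then have "i = length u" by simp
  then show ?case
    using map2_act_keep[of ts]
    by (simp add: step_machine program_delta_def Let_def keep_def fun_upd_idem)
next
  case (Suc n)
  then have i: "i < length u" and n: "length u - i + 1 = Suc (length u - Suc i + 1)" by auto
  have "step (machine K P) (length P + 6, (contents (take i u), int i) # (contents u, int i) # ts) =
      (length P + 6, (contents (take (Suc i) u), int (Suc i)) # (contents u, int (Suc i)) # ts)"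
    using i map2_act_keep[of ts]
    by (simp add: step_machine program_delta_def Let_def keep_def contents_nth
        sym_pos[THEN less_imp_neq, symmetric] contents_take_Suc fun_upd_idem add.commute)
  then show ?case
    using Suc(1)[of "Suc i"] Suc(2) i unfolding n funpow_Suc_right comp_def by simp
qed

lemma funpow_add_app: "(f ^^ m) x = y \<Longrightarrow> (f ^^ n) y = z \<Longrightarrow> (f ^^ (m + n)) x = z"
  by (metis add.commute comp_apply funpow_add)

lemma finish_success:
  assumes "i \<le> length w"
  shows "\<exists>t ts'. t \<le> 2 * length w + 2 * length u + 4 \<and>
    (step (machine K P) ^^ t) (length P + 1, (contents w, int i) # (contents u, int (length u)) # ts) =
    (length P + 7, (contents u, int (length u)) # ts')"
proof -
  obtain ts' where ts': "(step (machine K P) ^^ (length u - 0 + 1))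
     (length P + 6, (contents (take 0 u), int 0) # (contents u, int 0) # ts) =
   (length P + 7, (contents u, int (length u)) # ts')"
    using copy_output[of 0 u K P ts] by blast
  note 1 = scan_input_right[OF assms, of K P "(contents u, int (length u))" ts]
  have 2: "(step (machine K P) ^^ (length w + 1))
     (length P + 4, (contents w, int (length w) - 1) # (contents u, int (length u)) # ts) =
   (length P + 5, (contents [], 0) # (contents u, int (length u) - 1) # ts)"
    using erase_input[of "length w" w K P "contents u" "int (length u)" ts] by simp
  note 3 = rewind_output[of "length u" u K P "(contents [], 0)" ts, OF order_refl]
  have 4: "(step (machine K P) ^^ (length u + 1))
     (length P + 6, (contents [], 0) # (contents u, 0) # ts) =
   (length P + 7, (contents u, int (length u)) # ts')"
    using ts' by simp
  note 5 = funpow_add_app[OF funpow_add_app[OF funpow_add_app[OF 1 2] 3] 4]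
  show ?thesis
    by (rule exI, rule exI, rule conjI[OF _ 5]) simp
qed

text \<open>Once the partial output is erased, the situation is that of a successful run with empty
  output.\<close>

lemma finish_failure:
  assumes "i \<le> length w"
  shows "\<exists>t ts'. t \<le> 2 * length w + length u + 6 \<and>
    (step (machine K P) ^^ t) (length P + 2, (contents w, int i) # (contents u, int (length u)) # ts) =
    (length P + 7, (contents [], 0) # ts')"
proof -
  obtain t ts' where t: "t \<le> 2 * length w + 4"
    "(step (machine K P) ^^ t) (length P + 1, (contents w, int i) # (contents [], 0) # ts) =
    (length P + 7, (contents [], 0) # ts')"
    using finish_success[OF assms, of "[]" K P ts] by auto
  have 1: "(step (machine K P) ^^ 1) (length P + 2, (contents w, int i) # (contents u, int (length u)) # ts) =
     (length P + 3, (contents w, int i) # (contents u, int (length u) - 1) # ts)"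
    using map2_act_keep[of ts]
    by (simp add: step_machine program_delta_def Let_def keep_def fun_upd_idem)
  have 2: "(step (machine K P) ^^ (length u + 1))
     (length P + 3, (contents w, int i) # (contents u, int (length u) - 1) # ts) =
   (length P + 1, (contents w, int i) # (contents [], 0) # ts)"
    using erase_output[of "length u" u K P "(contents w, int i)" ts] by simp
  note 3 = funpow_add_app[OF funpow_add_app[OF 1 2] t(2)]
  show ?thesis
    by (rule exI, rule exI, rule conjI[OF _ 3]) (use t in simp)
qed

section \<open>Polynomial running time of programs\<close>

lemma step_halted: "(step M ^^ n) (states M, ts) = (states M, ts)"
  by (induction n) (auto simp: step.simps)

lemma polytimeI:
  assumes "\<And>w. \<exists>x. exec K (length w + 2) c (w, [], \<lambda>_. 0) x \<and>
    (case x of Some (r, u, C) \<Rightarrow> f w = u | None \<Rightarrow> f w = [])"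
  shows "polytime f"
proof -
  define P where "P = compile c 0"
  \<comment> \<open>With \<open>h\<close> program steps on an input of length l, the machine needs
    at most 1 + h + 2l + 2h + 6 steps, as the output has length at most \<open>h\<close>. The bound
    on \<open>h\<close> has the factor (l + 3)^K, because each counter takes a value from 0 to l +
    2; the other constants are generous.\<close>
  define p :: "nat poly" where
    "p = [:4 * length P:] * ([:1, 1:] * [:3, 1:] ^ K) + [:10, 2:]"
  have "computes_within (machine K P) w (f w) (poly p (length w))" for w
  proof -
    let ?M = "machine K P" and ?B = "length w + 2" and ?x = "(0 :: nat, w, [] :: bool list, \<lambda>_ :: nat. 0 :: nat)"
    obtain x where x: "exec K ?B c (w, [], \<lambda>_. 0) x"
      "case x of Some (r, u, C) \<Rightarrow> f w = u | None \<Rightarrow> f w = []"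
      using assms by blast
    have "lands K ?B P ?x (length P) x"
      using compile_correct[OF x(1), of P "[]" "[]"] by (simp add: P_def)
    then obtain y where y: "reach K ?B P ?x y" "length P \<le> fst y"
      "fst y = length P \<and> f w = fst (snd (snd y)) \<or> fst y = length P + 1 \<and> f w = []"
      using x(2) unfolding lands_def by (cases x) fastforce+
    \<comment> \<open>Minimality guarantees that the program counter is inside the code before time
      \<open>h\<close>, which is the range in which machine steps mirror program steps.\<close>
    define h where "h = (LEAST t. (istep P ^^ t) ?x = y)"
    obtain t where t: "t \<le> length P * (Suc (length w) * Suc ?B ^ K)" "(istep P ^^ t) ?x = y"
      "\<forall>i \<le> t. bounded K ?B ((istep P ^^ i) ?x)"
      using reach_halt_time[OF y(1,2)] by auto
    have h: "(istep P ^^ h) ?x = y" "h \<le> t"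
      unfolding h_def using t(2) by (rule LeastI, intro Least_le)
    have running: "fst ((istep P ^^ i) ?x) < length P" if "i < h" for i
    proof (rule ccontr)
      assume "\<not> fst ((istep P ^^ i) ?x) < length P"
      then have "(istep P ^^ (i + (h - i))) ?x = (istep P ^^ i) ?x"
        by (intro funpow_add_app[OF refl] funpow_halted) simp
      then have "(istep P ^^ i) ?x = y" using h that by simp
      then show False using not_less_Least that unfolding h_def by blast
    qed
    have 1: "(step ?M ^^ 1) (start_config ?M w) = tape_config K w ?x"
      by (simp add: initial_step)
    have 2: "(step ?M ^^ h) (tape_config K w ?x) = tape_config K w y"
      using simulate_steps[of h K ?B P w] t(3) h running by simp
    obtain pc r u C where y': "y = (pc, r, u, C)" by (cases y)
    have u: "length u \<le> h" using funpow_output_length[of h P ?x] h y' by simp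
    let ?i = "length w - length r"
    have tc: "tape_config K w y = (Suc pc, (contents w, int ?i) # (contents u, int (length u)) #
        map (\<lambda>j. (contents [False], int (C j))) [0..<K])"
      by (simp add: y' tape_config_def)
    obtain t' ts' k where t': "t' \<le> 2 * length w + 2 * length u + 6"
      "(step ?M ^^ t') (tape_config K w y) = (length P + 7, (contents (f w), k) # ts')"
    proof (cases "fst y = length P \<and> f w = u")
      case True
      then have pc: "Suc pc = length P + 1" "f w = u" using y' by auto
      obtain t' ts' where "t' \<le> 2 * length w + 2 * length u + 4"
        "(step ?M ^^ t') (tape_config K w y) = (length P + 7, (contents u, int (length u)) # ts')"
        using finish_success[OF diff_le_self] unfolding tc pc(1) by blast
      then show ?thesis using that[of t' "int (length u)" ts'] pc(2) by simp
    next
      case False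
      then have pc: "Suc pc = length P + 2" "f w = []" using y(3) y' by auto
      obtain t' ts' where "t' \<le> 2 * length w + length u + 6"
        "(step ?M ^^ t') (tape_config K w y) = (length P + 7, (contents [], 0) # ts')"
        using finish_failure[OF diff_le_self] unfolding tc pc(1) by blast
      then show ?thesis using that[of t' 0 ts'] pc(2) by simp
    qed
    let ?t = "1 + h + t'"
    have T: "(step ?M ^^ ?t) (start_config ?M w) = (states ?M, (contents (f w), k) # ts')"
      using funpow_add_app[OF funpow_add_app[OF 1 2] t'(2)] by (simp add: machine_def)
    have "poly p (length w) =
        4 * (length P * (Suc (length w) * (length w + 3) ^ K)) + 2 * length w + 10"
      by (simp add: p_def poly_power algebra_simps)
    moreover have "Suc ?B = length w + 3" by simp
    ultimately have "?t \<le> poly p (length w)"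
      using t' h t(1)[unfolded \<open>Suc ?B = length w + 3\<close>] u by linarith
    then have "(step ?M ^^ poly p (length w)) (start_config ?M w) =
        (states ?M, (contents (f w), k) # ts')"
      using funpow_add_app[OF T step_halted, of "poly p (length w) - ?t"] by simp
    then show ?thesis by (simp add: computes_within_def)
  qed
  then show ?thesis unfolding polytime_def using wf_machine by blast
qed

section \<open>Program building blocks\<close>

text \<open>Counters 0, 1 and 2 are scratch space; they are 0 before and after each of these programs.\<close>

definition clear :: "nat \<Rightarrow> com" where
  "clear i = While (Pos i) (Dec i)"

definition emit :: "nat \<Rightarrow> com" where
  "emit i = While (Pos i) (Dec i ;; Inc 0 ;; Out True) ;; While (Pos 0) (Dec 0 ;; Inc i)"

definition copy :: "nat \<Rightarrow> nat \<Rightarrow> com" where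
  "copy i j = While (Pos i) (Dec i ;; Inc j ;; Inc 0) ;; While (Pos 0) (Dec 0 ;; Inc i)"

definition compare :: "nat \<Rightarrow> nat \<Rightarrow> com \<Rightarrow> com \<Rightarrow> com \<Rightarrow> com" where
  "compare i j lt eq gt =
    copy i 1 ;; copy j 2 ;; While (And (Pos 1) (Pos 2)) (Dec 1 ;; Dec 2) ;;
    If (Pos 1) (clear 1 ;; gt) (If (Pos 2) (clear 2 ;; lt) eq)"

text \<open>Counter \<open>j\<close> ascends for use by the body, while \<open>k\<close> holds the
  number of rounds left, so that the loop test is a mere test for zero.\<close>

definition count_up :: "nat \<Rightarrow> nat \<Rightarrow> nat \<Rightarrow> com \<Rightarrow> com" where
  "count_up m k j c = copy m k ;; While (Pos k) (c ;; Inc j ;; Dec k) ;; clear j"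

section \<open>Correctness of the building blocks\<close>

lemma exec_While_False:
  "\<not> holds t s \<Longrightarrow> s' = s \<Longrightarrow> exec K B (While t c) s (Some s')"
  using exec.While_False by simp

lemma exec_clear: "exec K B (clear i) (r, u, C) (Some (r, u, C(i := 0)))"
proof (induction "C i" arbitrary: C)
  case 0
  then have "C(i := 0) = C" by auto
  then show ?case using 0 unfolding clear_def
    by (metis exec.While_False holds.simps(3) less_numeral_extra(3))
next
  case (Suc n)
  have "exec K B (clear i) (r, u, C(i := n)) (Some (r, u, C(i := 0)))"
    using Suc(1)[of "C(i := n)"] by simp
  moreover have "C i - 1 = n" using Suc(2) by simp
  ultimately show ?case using Suc(2) exec.Dec[of K B i r u C] unfolding clear_def
    by (metis exec.While_True holds.simps(3) zero_less_Suc)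
qed

lemma exec_move:
  assumes "i \<noteq> j" "j < K" "C i + C j \<le> B"
  shows "exec K B (While (Pos i) (Dec i ;; Inc j)) (r, u, C)
    (Some (r, u, C(i := 0, j := C i + C j)))"
  using assms(3)
proof (induction "C i" arbitrary: C)
  case 0
  then have "C(i := 0, j := C i + C j) = C" by auto
  then show ?case using 0 by (intro exec_While_False) auto
next
  case (Suc n)
  let ?C = "C(i := n, j := Suc (C j))"
  have n: "C i - 1 = n" using Suc(2) by simp
  have "exec K B (Dec i ;; Inc j) (r, u, C) (Some (r, u, ?C))"
    using exec.Dec[of K B i r u C] exec.Inc[of j K "C(i := n)" B r u] assms Suc(2,3) n
    by (intro exec.Seq[of _ _ _ _ "(r, u, C(i := n))"]) auto
  moreover have "?C(i := 0, j := ?C i + ?C j) = C(i := 0, j := C i + C j)"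
    using Suc(2) assms(1) by auto
  moreover have "exec K B (While (Pos i) (Dec i ;; Inc j)) (r, u, ?C)
      (Some (r, u, ?C(i := 0, j := ?C i + ?C j)))"
    using Suc assms(1) by (intro Suc(1)) auto
  ultimately show ?case using Suc(2) by (metis exec.While_True holds.simps(3) zero_less_Suc)
qed

lemma exec_emit:
  assumes "C 0 = 0" "i \<noteq> 0" "i < K" "C i \<le> B"
  shows "exec K B (emit i) (r, u, C) (Some (r, u @ replicate (C i) True, C))"
proof -
  have *: "exec K B (While (Pos i) (Dec i ;; Inc 0 ;; Out True)) (r, u, C)
      (Some (r, u @ replicate (C i) True, C(i := 0, 0 := C i + C 0)))"
    if "C i + C 0 \<le> B" for u C
    using that
  proof (induction "C i" arbitrary: C u)
    case 0
    then have "C(i := 0, 0 := C i + C 0) = C" by auto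
    then show ?case using 0 by (intro exec_While_False) auto
  next
    case (Suc n)
    let ?C = "C(i := n, 0 := Suc (C 0))"
    have n: "C i - 1 = n" using Suc(2) by simp
    have "exec K B (Inc 0 ;; Out True) (r, u, C(i := n)) (Some (r, u @ [True], ?C))"
      using exec.Inc[of 0 K "C(i := n)" B r u] exec.Out[of K B True r u ?C] assms Suc(2,3) n
      by (intro exec.Seq[of _ _ _ _ "(r, u, ?C)"]) auto
    then have "exec K B (Dec i ;; Inc 0 ;; Out True) (r, u, C) (Some (r, u @ [True], ?C))"
      using exec.Dec[of K B i r u C] n
      by (auto intro: exec.Seq[of _ _ _ _ "(r, u, C(i := n))"])
    moreover have "?C(i := 0, 0 := ?C i + ?C 0) = C(i := 0, 0 := C i + C 0)"
      using Suc(2) assms(2) by auto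
    moreover have "exec K B (While (Pos i) (Dec i ;; Inc 0 ;; Out True)) (r, u @ [True], ?C)
        (Some (r, (u @ [True]) @ replicate (?C i) True, ?C(i := 0, 0 := ?C i + ?C 0)))"
      using Suc assms(2) by (intro Suc(1)) auto
    moreover have "(u @ [True]) @ replicate (?C i) True = u @ replicate (C i) True"
      using Suc(2)[symmetric] assms(2) by simp
    ultimately show ?case using Suc(2) by (metis exec.While_True holds.simps(3) zero_less_Suc)
  qed
  let ?C = "C(i := 0, 0 := C i)"
  have "?C(0 := 0, i := ?C 0 + ?C i) = C" using assms by auto
  then have "exec K B (While (Pos 0) (Dec 0 ;; Inc i)) (r, u @ replicate (C i) True, ?C)
      (Some (r, u @ replicate (C i) True, C))"
    using exec_move[of 0 i K ?C B r "u @ replicate (C i) True"] assms by simp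
  then show ?thesis
    unfolding emit_def using *[of C u] assms by (intro exec.Seq) auto
qed

lemma exec_copy:
  assumes "C 0 = 0" "i \<noteq> 0" "j \<noteq> 0" "i \<noteq> j" "i < K" "j < K" "C i + C j \<le> B"
  shows "exec K B (copy i j) (r, u, C) (Some (r, u, C(j := C i + C j)))"
proof -
  have *: "exec K B (While (Pos i) (Dec i ;; Inc j ;; Inc 0)) (r, u, C)
      (Some (r, u, C(i := 0, j := C i + C j, 0 := C i + C 0)))"
    if "C i + C j \<le> B" "C i + C 0 \<le> B" for C
    using that
  proof (induction "C i" arbitrary: C)
    case 0
    then have "C(i := 0, j := C i + C j, 0 := C i + C 0) = C" by auto
    then show ?case using 0 by (intro exec_While_False) auto
  next
    case (Suc n)
    let ?C = "C(i := n, j := Suc (C j), 0 := Suc (C 0))"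
    have n: "C i - 1 = n" using Suc(2) by simp
    have "exec K B (Inc j ;; Inc 0) (r, u, C(i := n)) (Some (r, u, ?C))"
      using exec.Inc[of j K "C(i := n)" B r u] assms Suc(2-4) n
        exec.Inc[of 0 K "C(i := n, j := Suc (C j))" B r u]
      by (intro exec.Seq[of _ _ _ _ "(r, u, C(i := n, j := Suc (C j)))"]) auto
    then have "exec K B (Dec i ;; Inc j ;; Inc 0) (r, u, C) (Some (r, u, ?C))"
      using exec.Dec[of K B i r u C] n
      by (auto intro: exec.Seq[of _ _ _ _ "(r, u, C(i := n))"])
    moreover have "?C(i := 0, j := ?C i + ?C j, 0 := ?C i + ?C 0) =
        C(i := 0, j := C i + C j, 0 := C i + C 0)"
      using Suc(2) assms by auto
    moreover have "exec K B (While (Pos i) (Dec i ;; Inc j ;; Inc 0)) (r, u, ?C)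
        (Some (r, u, ?C(i := 0, j := ?C i + ?C j, 0 := ?C i + ?C 0)))"
      using Suc assms by (intro Suc(1)) auto
    ultimately show ?case using Suc(2) by (metis exec.While_True holds.simps(3) zero_less_Suc)
  qed
  let ?C = "C(i := 0, j := C i + C j, 0 := C i)"
  have "?C(0 := 0, i := ?C 0 + ?C i) = C(j := C i + C j)" using assms by auto
  then have "exec K B (While (Pos 0) (Dec 0 ;; Inc i)) (r, u, ?C)
      (Some (r, u, C(j := C i + C j)))"
    using exec_move[of 0 i K ?C B r u] assms by simp
  then show ?thesis
    unfolding copy_def using *[of C] assms by (intro exec.Seq) auto
qed

text \<open>Decrementing two copies in parallel leaves the truncated differences, at most one of
  which is positive; this decides between the three cases. The scratch counters are cleared before a
  branch starts, so comparisons can be nested.\<close>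

lemma exec_compare:
  assumes "C 0 = 0" "C 1 = 0" "C 2 = 0" "2 < i" "2 < j" "i < K" "j < K" "C i \<le> B" "C j \<le> B"
    and "exec K B (if C i < C j then lt else if C i = C j then eq else gt) (r, u, C) x"
  shows "exec K B (compare i j lt eq gt) (r, u, C) x"
proof -
  have *: "exec K B (While (And (Pos 1) (Pos 2)) (Dec 1 ;; Dec 2)) (r, u, C(1 := a, 2 := b))
      (Some (r, u, C(1 := a - b, 2 := b - a)))" for a b
  proof (induction a arbitrary: b)
    case 0
    then show ?case by (intro exec_While_False) auto
  next
    case (Suc a)
    show ?case
    proof (cases b)
      case 0
      then show ?thesis
        by (intro exec_While_False) auto
    next
      case (Suc b')
      have "C(1 := Suc a, 2 := b, 1 := a) = C(1 := a, 2 := b)" by auto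
      then have 1: "exec K B (Dec 1) (r, u, C(1 := Suc a, 2 := b)) (Some (r, u, C(1 := a, 2 := b)))"
        using exec.Dec[of K B 1 r u "C(1 := Suc a, 2 := b)"] by simp
      have 2: "exec K B (Dec 2) (r, u, C(1 := a, 2 := b)) (Some (r, u, C(1 := a, 2 := b')))"
        using exec.Dec[of K B 2 r u "C(1 := a, 2 := b)"] Suc by simp
      show ?thesis
        using exec.While_True[OF _ exec.Seq[OF 1 2] Suc.IH[of b']] Suc
        by (simp del: fun_upd_apply add: fun_upd_same fun_upd_other)
    qed
  qed
  have 1: "exec K B (copy i 1) (r, u, C) (Some (r, u, C(1 := C i)))"
    using exec_copy[of C i 1 K B r u] assms by simp
  have 2: "exec K B (copy j 2) (r, u, C(1 := C i)) (Some (r, u, C(1 := C i, 2 := C j)))"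
    using exec_copy[of "C(1 := C i)" j 2 K B r u] assms by simp
  have C12: "C(1 := 0, 2 := 0) = C" using assms by auto
  let ?C = "C(1 := C i - C j, 2 := C j - C i)"
  have "exec K B (If (Pos 1) (clear 1 ;; gt) (If (Pos 2) (clear 2 ;; lt) eq)) (r, u, ?C) x"
  proof (cases "C i" "C j" rule: linorder_cases)
    case less
    have "?C(2 := 0) = C" using C12 less by simp
    then have "exec K B (clear 2) (r, u, ?C) (Some (r, u, C))" using exec_clear[of K B 2 r u ?C] by simp
    then show ?thesis
      using less assms(10) by (intro exec.If_False exec.If_True exec.Seq) auto
  next
    case equal
    then show ?thesis using C12 assms(2,3,10) by (intro exec.If_False) auto
  next
    case greater
    have "?C(1 := 0) = C" using C12 greater by (simp add: fun_upd_twist)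
    then have "exec K B (clear 1) (r, u, ?C) (Some (r, u, C))" using exec_clear[of K B 1 r u ?C] by simp
    then show ?thesis
      using greater assms(10) by (intro exec.If_True exec.Seq) auto
  qed
  then show ?thesis
    unfolding compare_def by (rule exec.Seq[OF 1 exec.Seq[OF 2 exec.Seq[OF *]]])
qed

lemma exec_count_up:
  assumes "C 0 = 0" "C j = 0" "C k = 0" "m \<noteq> 0" "k \<noteq> 0" "m \<noteq> k" "j \<noteq> m" "j \<noteq> k"
    "m < K" "k < K" "j < K" "C m \<le> B"
    and c: "\<And>l u. l < C m \<Longrightarrow> exec K B c (r, u, C(j := l, k := C m - l))
      (Some (r, u @ g l, C(j := l, k := C m - l)))"
  shows "exec K B (count_up m k j c) (r, u, C) (Some (r, u @ concat (map g [0..<C m]), C))"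
proof -
  let ?C = "\<lambda>l. C(j := l, k := C m - l)"
  \<comment> \<open>The induction is on the number \<open>n\<close> of rounds left, so the loop is
    entered at index \<open>C m - n\<close>.\<close>
  have *: "exec K B (While (Pos k) (c ;; Inc j ;; Dec k)) (r, u, ?C (C m - n))
      (Some (r, u @ concat (map g [C m - n..<C m]), ?C (C m)))" if "n \<le> C m" for n u
    using that
  proof (induction n arbitrary: u)
    case 0
    then show ?case by (intro exec_While_False) auto
  next
    case (Suc n)
    let ?l = "C m - Suc n"
    have "Suc ?l = C m - n" using Suc.prems by simp
    then have l: "Suc ?l = C m - n" "C m - ?l = Suc n" "[?l..<C m] = ?l # [C m - n..<C m]"
      using Suc.prems upt_conv_Cons[of ?l "C m"] by auto
    have "exec K B (Inc j) (r, u @ g ?l, ?C ?l) (Some (r, u @ g ?l, (?C ?l)(j := C m - n)))"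
      using exec.Inc[of j K "?C ?l" B r "u @ g ?l"] assms l Suc.prems by simp
    moreover have "exec K B (Dec k) (r, u @ g ?l, (?C ?l)(j := C m - n))
        (Some (r, u @ g ?l, ?C (C m - n)))"
    proof -
      have "(?C ?l)(j := C m - n, k := ((?C ?l)(j := C m - n)) k - 1) = ?C (C m - n)"
        using assms(8) l Suc.prems by (auto simp: fun_eq_iff)
      then show ?thesis using exec.Dec[of K B k r "u @ g ?l" "(?C ?l)(j := C m - n)"] by simp
    qed
    moreover have "exec K B c (r, u, ?C ?l) (Some (r, u @ g ?l, ?C ?l))"
      using Suc.prems by (intro c) simp
    ultimately have "exec K B (c ;; Inc j ;; Dec k) (r, u, ?C ?l)
        (Some (r, u @ g ?l, ?C (C m - n)))"
      by (intro exec.Seq) auto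
    from exec.While_True[OF _ this Suc.IH[of "u @ g ?l"]] Suc.prems l show ?case
      using assms(8) by (simp del: fun_upd_apply add: fun_upd_same fun_upd_other)
  qed
  have C0: "?C 0 = C(k := C m + C k)" using assms by auto
  have C1: "(?C (C m))(j := 0) = C" using assms by auto
  have 1: "exec K B (copy m k) (r, u, C) (Some (r, u, ?C 0))"
    unfolding C0 using assms by (intro exec_copy) auto
  have 2: "exec K B (While (Pos k) (c ;; Inc j ;; Dec k)) (r, u, ?C 0)
      (Some (r, u @ concat (map g [0..<C m]), ?C (C m)))"
    using *[of "C m" u] by simp
  have 3: "exec K B (clear j) (r, u @ concat (map g [0..<C m]), ?C (C m))
      (Some (r, u @ concat (map g [0..<C m]), C))"
    using exec_clear[of K B j r "u @ concat (map g [0..<C m])" "?C (C m)"] unfolding C1 .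
  show ?thesis
    unfolding count_up_def by (rule exec.Seq[OF 1 exec.Seq[OF 2 3]])
qed


section \<open>Parsing programs\<close>

definition expect :: "bool \<Rightarrow> com" where
  "expect b = If (Sees (Some b)) Read Fail"

definition read_nat :: "nat \<Rightarrow> com" where
  "read_nat i = While (Sees (Some True)) (Read ;; Inc i) ;; expect False"

definition read_list :: "com \<Rightarrow> com" where
  "read_list c = While (Sees (Some True)) (Read ;; c) ;; expect False"

text \<open>
  Started with counters \<open>C\<close>, the program \<open>c\<close> consumes a prefix \<open>e x\<close> of the input with \<open>P x\<close>,
  writes \<open>g x\<close> and leaves the counters \<open>D x\<close>; it fails if there is no such prefix.
\<close>

definition parses ::
    "nat \<Rightarrow> nat \<Rightarrow> (nat \<Rightarrow> nat) \<Rightarrow> com \<Rightarrow> ('a \<Rightarrow> bool list) \<Rightarrow> ('a \<Rightarrow> bool) \<Rightarrow> ('a \<Rightarrow> bool list) \<Rightarrow>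
     ('a \<Rightarrow> nat \<Rightarrow> nat) \<Rightarrow> bool" where
  "parses K L C c e P g D \<longleftrightarrow>
    (\<forall>x r u. P x \<longrightarrow> length (e x @ r) \<le> L \<longrightarrow>
      exec K (L + 2) c (e x @ r, u, C) (Some (r, u @ g x, D x))) \<and>
    (\<forall>i u. length i \<le> L \<longrightarrow> (\<forall>x r. i = e x @ r \<longrightarrow> \<not> P x) \<longrightarrow>
      exec K (L + 2) c (i, u, C) None)"

section \<open>Composition of parsers\<close>

lemma parses_Some:
  "parses K L C c e P g D \<Longrightarrow> P x \<Longrightarrow> length (e x @ r) \<le> L \<Longrightarrow>
    exec K (L + 2) c (e x @ r, u, C) (Some (r, u @ g x, D x))"
  by (simp add: parses_def)

lemma parses_None:
  "parses K L C c e P g D \<Longrightarrow> length i \<le> L \<Longrightarrow> (\<And>x r. i = e x @ r \<Longrightarrow> \<not> P x) \<Longrightarrow>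
    exec K (L + 2) c (i, u, C) None"
  unfolding parses_def by blast

lemma parsesI:
  assumes "\<And>x r u. P x \<Longrightarrow> length (e x @ r) \<le> L \<Longrightarrow>
      exec K (L + 2) c (e x @ r, u, C) (Some (r, u @ g x, D x))"
    and "\<And>i u. length i \<le> L \<Longrightarrow> (\<And>x r. i = e x @ r \<Longrightarrow> \<not> P x) \<Longrightarrow>
      exec K (L + 2) c (i, u, C) None"
  shows "parses K L C c e P g D"
  unfolding parses_def using assms by blast

text \<open>The second parser may depend on the value read first, through the counters
  \<open>D x\<close>; this is how arguments are compared with the number of variables. The bound on
  \<open>length (e x)\<close> is handed on because it bounds the numbers stored in these
  counters.\<close>

lemma parses_Seq:
  assumes c: "parses K L C c e P g D"
    and d: "\<And>x. P x \<Longrightarrow> length (e x) \<le> L \<Longrightarrow> parses K L (D x) d e' (P' x) (g' x) (D' x)"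
  shows "parses K L C (c ;; d) (\<lambda>(x, y). e x @ e' y) (\<lambda>(x, y). P x \<and> P' x y)
    (\<lambda>(x, y). g x @ g' x y) (\<lambda>(x, y). D' x y)"
proof (rule parsesI, goal_cases)
  case (1 z r u)
  obtain x y where z: "z = (x, y)" by (cases z)
  have 2: "exec K (L + 2) c (e x @ e' y @ r, u, C) (Some (e' y @ r, u @ g x, D x))"
    using 1 z by (intro parses_Some[OF c]) auto
  have 3: "exec K (L + 2) d (e' y @ r, u @ g x, D x) (Some (r, (u @ g x) @ g' x y, D' x y))"
    using 1 z by (intro parses_Some[OF d]) auto
  show ?case using exec.Seq[OF 2 3] z by simp
next
  case (2 i u)
  show ?case
  proof (cases "\<exists>x r. i = e x @ r \<and> P x")
    case True
    then obtain x r where x: "i = e x @ r" "P x" by blast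
    then have 3: "exec K (L + 2) c (i, u, C) (Some (r, u @ g x, D x))"
      using 2 parses_Some[OF c] by blast
    have "\<not> P' x y" if "r = e' y @ r'" for y r'
      using 2(2)[of "(x, y)" r'] x that by simp
    then have "exec K (L + 2) d (r, u @ g x, D x) None"
      using 2 x by (intro parses_None[OF d]) auto
    then show ?thesis by (rule exec.Seq[OF 3])
  next
    case False
    then show ?thesis using 2 by (intro exec.Seq_None parses_None[OF c]) auto
  qed
qed

text \<open>For a second program that consumes no input: it prints what has been read or checks a
  condition \<open>Q\<close> on it.\<close>

lemma parses_then:
  assumes c: "parses K L C c e P g D"
    and d: "\<And>x r u. P x \<Longrightarrow> length (e x) \<le> L \<Longrightarrow>
      exec K (L + 2) d (r, u, D x) (if Q x then Some (r, u @ h x, D' x) else None)"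
  shows "parses K L C (c ;; d) e (\<lambda>x. P x \<and> Q x) (\<lambda>x. g x @ h x) D'"
proof (rule parsesI, goal_cases)
  case (1 x r u)
  then show ?case using d[of x r "u @ g x"]
    by (intro exec.Seq[OF parses_Some[OF c]]) auto
next
  case (2 i u)
  show ?case
  proof (cases "\<exists>x r. i = e x @ r \<and> P x")
    case True
    then obtain x r where x: "i = e x @ r" "P x" by blast
    then have 3: "exec K (L + 2) c (i, u, C) (Some (r, u @ g x, D x))"
      using 2 parses_Some[OF c] by blast
    show ?thesis using d[of x r "u @ g x"] 2 x by (intro exec.Seq[OF 3]) auto
  next
    case False
    then show ?thesis using 2 by (intro exec.Seq_None parses_None[OF c]) auto
  qed
qed

section \<open>Parsing bits, numbers and lists\<close>

lemma exec_expect: "exec K B (expect b) (b # r, u, C) (Some (r, u, C))"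
  unfolding expect_def by (intro exec.If_True exec.Read) simp

lemma exec_expect_None: "peek r \<noteq> Some b \<Longrightarrow> exec K B (expect b) (r, u, C) None"
  unfolding expect_def by (intro exec.If_False exec.Fail) simp

lemma parses_expect:
  assumes "parses K L C c e P g D"
  shows "parses K L C (expect b ;; c) (\<lambda>x. b # e x) P g D"
proof (rule parsesI, goal_cases)
  case (1 x r u)
  then show ?case
    using exec.Seq[OF exec_expect parses_Some[OF assms]] by simp
next
  case (2 i u)
  show ?case
  proof (cases "peek i = Some b")
    case True
    then obtain i' where i: "i = b # i'" by (cases i) auto
    show ?thesis
      unfolding i using 2 i by (intro exec.Seq[OF exec_expect] parses_None[OF assms]) auto
  qed (intro exec.Seq_None exec_expect_None)
qed

lemma parses_expect_last:
  assumes "parses K L C c e P g D"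
  shows "parses K L C (c ;; expect b) (\<lambda>x. e x @ [b]) P g D"
proof (rule parsesI, goal_cases)
  case (1 x r u)
  then show ?case
    using exec.Seq[OF parses_Some[OF assms, of x "b # r"] exec_expect] by simp
next
  case (2 i u)
  show ?case
  proof (cases "\<exists>x r. i = e x @ r \<and> P x")
    case True
    then obtain x r where x: "i = e x @ r" "P x" by blast
    have "peek r \<noteq> Some b" using 2(2)[of x "tl r"] x by (cases r) auto
    then show ?thesis
      using x 2(1) unfolding x(1)
      by (intro exec.Seq[OF parses_Some[OF assms]] exec_expect_None) auto
  next
    case False
    then show ?thesis using 2 by (intro exec.Seq_None parses_None[OF assms]) auto
  qed
qed

lemma parses_cong:
  assumes "parses K L C c e P g D" "\<And>x. e x = e' x" "\<And>x. P x = P' x" "\<And>x. P x \<Longrightarrow> g x = g' x"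
    "\<And>x. P x \<Longrightarrow> D x = D' x"
  shows "parses K L C c e' P' g' D'"
proof -
  have "e = e'" "P = P'" using assms by auto
  then show ?thesis using assms unfolding parses_def by simp
qed

lemma parses_nat:
  assumes "C i = 0" "i < K"
  shows "parses K L C (read_nat i) enc_nat (\<lambda>_. True) (\<lambda>_. []) (\<lambda>k. C(i := k))"
proof -
  have *: "exec K (L + 2) (While (Sees (Some True)) (Read ;; Inc i)) (replicate k True @ r, u, C(i := l))
      (Some (r, u, C(i := l + k)))" if "l + k \<le> L" "peek r \<noteq> Some True" for k l r u
    using that(1)
  proof (induction k arbitrary: l)
    case 0
    then show ?case using that(2) by (intro exec_While_False) auto
  next
    case (Suc k)
    have "exec K (L + 2) (Inc i) (replicate k True @ r, u, C(i := l))
        (Some (replicate k True @ r, u, C(i := Suc l)))"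
      using exec.Inc[of i K "C(i := l)" "L + 2"] Suc.prems assms by simp
    then have "exec K (L + 2) (Read ;; Inc i) (True # replicate k True @ r, u, C(i := l))
        (Some (replicate k True @ r, u, C(i := Suc l)))"
      by (intro exec.Seq[OF exec.Read])
    from exec.While_True[OF _ this Suc.IH[of "Suc l"]] Suc.prems show ?case
      by (simp del: fun_upd_apply)
  qed
  have C: "C(i := 0) = C" using assms by auto
  show ?thesis
  proof (rule parsesI, goal_cases)
    case (1 k r u)
    then show ?case
      using exec.Seq[OF *[of 0 k "False # r" u] exec_expect] unfolding C
      by (simp add: read_nat_def enc_nat_def)
  next
    case (2 w u)
    \<comment> \<open>A word without a prefix \<open>enc_nat k\<close> contains no
      \<open>False\<close>. The loop therefore exhausts it, and \<open>expect False\<close> fails at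
      the end of the input.\<close>
    let ?k = "length (takeWhile id w)"
    have tw: "takeWhile id w = replicate ?k True"
      by (rule replicate_eqI[symmetric, THEN sym]) (auto dest: set_takeWhileD)
    have dw: "dropWhile id w = []"
    proof (cases "dropWhile id w")
      case (Cons b r)
      then have "\<not> b" using hd_dropWhile[of id w] by simp
      then have "w = enc_nat ?k @ r"
        using Cons tw takeWhile_dropWhile_id[of id w] by (simp add: enc_nat_def)
      then show ?thesis using 2 by blast
    qed
    then have w: "w = replicate ?k True @ []"
      using tw takeWhile_dropWhile_id[of id w] by (metis append_Nil2)
    have "?k \<le> L" using 2(1) w by (metis append_Nil2 length_replicate)
    then have "exec K (L + 2) (While (Sees (Some True)) (Read ;; Inc i)) (w, u, C)
        (Some ([], u, C(i := ?k)))"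
      using *[of 0 ?k "[]" u] w C by simp
    then show ?case
      unfolding read_nat_def by (rule exec.Seq) (simp add: exec_expect_None)
  qed
qed

lemma parses_list:
  assumes c: "parses K L C c e P g (\<lambda>_. C)"
  shows "parses K L C (read_list c) (enc_list e) (\<lambda>xs. \<forall>x \<in> set xs. P x)
    (\<lambda>xs. concat (map g xs)) (\<lambda>_. C)"
proof (rule parsesI, goal_cases)
  let ?W = "While (Sees (Some True)) (Read ;; c)"
  case (1 xs r u)
  have "exec K (L + 2) ?W (enc_list e xs @ r, u, C)
      (Some (False # r, u @ concat (map g xs), C))"
    using 1
  proof (induction xs arbitrary: u)
    case Nil
    then show ?case
      using exec.While_False[of "Sees (Some True)" "(False # r, u, C)"] by (simp add: enc_list_def)
  next
    case (Cons x xs)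
    have "exec K (L + 2) c (e x @ enc_list e xs @ r, u, C) (Some (enc_list e xs @ r, u @ g x, C))"
      using Cons.prems by (intro parses_Some[OF c]) (auto simp: enc_list_def)
    then have "exec K (L + 2) (Read ;; c) (True # e x @ enc_list e xs @ r, u, C)
        (Some (enc_list e xs @ r, u @ g x, C))"
      by (intro exec.Seq[OF exec.Read])
    from exec.While_True[OF _ this Cons.IH[of "u @ g x"]] Cons.prems show ?case
      by (simp add: enc_list_def)
  qed
  then show ?case unfolding read_list_def by (rule exec.Seq[OF _ exec_expect])
next
  let ?W = "While (Sees (Some True)) (Read ;; c)"
  case (2 i u)
  \<comment> \<open>On bad input the loop may fail inside an element or stop regularly, but in the
    latter case never in front of \<open>False\<close>, so that the closing
    \<open>expect False\<close> fails. Each round reads at least its leading \<open>True\<close>,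
    hence the induction on the length.\<close>
  then have "exec K (L + 2) ?W (i, u, C) None \<or>
      (\<exists>i' u'. peek i' \<noteq> Some False \<and> exec K (L + 2) ?W (i, u, C) (Some (i', u', C)))"
  proof (induction "length i" arbitrary: i u rule: less_induct)
    case less
    show ?case
    proof (cases "peek i = Some True")
      case False
      moreover have "peek i \<noteq> Some False"
        using less(3)[of "[]" "tl i"] by (cases i) (auto simp: enc_list_def)
      ultimately show ?thesis
        using exec.While_False[of "Sees (Some True)" "(i, u, C)"] by fastforce
    next
      case True
      then obtain j where i: "i = True # j" by (cases i) auto
      show ?thesis
      proof (cases "\<exists>x r. j = e x @ r \<and> P x")
        case True
        then obtain x r where x: "j = e x @ r" "P x" by blast
        have 3: "exec K (L + 2) (Read ;; c) (i, u, C) (Some (r, u @ g x, C))"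
          unfolding i x(1) using less(2) x i by (intro exec.Seq[OF exec.Read] parses_Some[OF c]) auto
        have "\<not> (\<forall>y \<in> set ys. P y)" if "r = enc_list e ys @ r'" for ys r'
          using less(3)[of "x # ys" r'] x i that by (auto simp: enc_list_def)
        then have "exec K (L + 2) ?W (r, u @ g x, C) None \<or> (\<exists>i' u'. peek i' \<noteq> Some False \<and>
            exec K (L + 2) ?W (r, u @ g x, C) (Some (i', u', C)))"
          using less(2) i x by (intro less(1)) auto
        then show ?thesis
          using exec.While_True[OF _ 3, of "Sees (Some True)"] i by auto
      next
        case False
        then have "exec K (L + 2) (Read ;; c) (i, u, C) None"
          unfolding i using less(2) i by (intro exec.Seq[OF exec.Read] parses_None[OF c]) auto
        then show ?thesis
          using exec.While_None[of "Sees (Some True)" "(i, u, C)"] i by auto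
      qed
    qed
  qed
  then show ?case
    unfolding read_list_def by (meson exec.Seq exec.Seq_None exec_expect_None)
qed

text \<open>The parser also accepts words that continue after an encoding, so the end of the input
  is checked in addition. By prefix-freeness the parsed prefix determines \<open>x\<close>, and a
  word with a remainder is not itself an encoding. The hypothesis is for all \<open>L\<close>
  because the run on \<open>w\<close> takes \<open>L = length w\<close>.\<close>

lemma polytime_parser:
  assumes c: "\<And>L. parses K L (\<lambda>_. 0) c e P g D"
    and prefix_free: "\<And>x y r. e x @ r = e y \<Longrightarrow> x = y \<and> r = []"
  shows "\<exists>f. polytime f \<and> (\<forall>x. P x \<longrightarrow> f (e x) = g x) \<and>
    (\<forall>w. (\<forall>x. w = e x \<longrightarrow> \<not> P x) \<longrightarrow> f w = [])"
proof -
  define f where "f w = (if \<exists>x. w = e x \<and> P x then g (SOME x. w = e x) else [])" for w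
  have f: "f (e x) = g x" if "P x" for x
  proof -
    have "(SOME y. e x = e y) = x" using prefix_free[of x "[]"] by (intro some_equality) auto
    then show ?thesis using that unfolding f_def by auto
  qed
  have f': "f w = []" if "\<And>x. w = e x \<Longrightarrow> \<not> P x" for w
    using that unfolding f_def by auto
  let ?c = "c ;; If (Sees None) Skip Fail"
  have "\<exists>x. exec K (length w + 2) ?c (w, [], \<lambda>_. 0) x \<and>
    (case x of Some (r, u, C) \<Rightarrow> f w = u | None \<Rightarrow> f w = [])" for w
  proof (cases "\<exists>x r. w = e x @ r \<and> P x")
    case True
    then obtain x r where x: "w = e x @ r" "P x" by blast
    then have "length (e x @ r) \<le> length w" by simp
    then have c': "exec K (length w + 2) c (w, [], \<lambda>_. 0) (Some (r, [] @ g x, D x))"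
      using parses_Some[OF c, where x = x and r = r and L = "length w" and u = "[]"] x by blast
    show ?thesis
    proof (cases r)
      case Nil
      then have "exec K (length w + 2) ?c (w, [], \<lambda>_. 0) (Some ([], [] @ g x, D x))"
        by (intro exec.Seq[OF c'] exec.If_True) (auto intro: exec.Skip)
      then show ?thesis using x Nil f by (intro exI[of _ "Some ([], g x, D x)"]) auto
    next
      case (Cons b r')
      then have "exec K (length w + 2) ?c (w, [], \<lambda>_. 0) None"
        by (intro exec.Seq[OF c'] exec.If_False exec.Fail) auto
      moreover have "f w = []" using prefix_free[of x "b # r'"] x Cons by (intro f') force
      ultimately show ?thesis by (intro exI[of _ None]) auto
    qed
  next
    case False
    then have "exec K (length w + 2) ?c (w, [], \<lambda>_. 0) None"
      by (intro exec.Seq_None parses_None[OF c]) auto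
    moreover have "f w = []" using False by (intro f') auto
    ultimately show ?thesis by (intro exI[of _ None]) auto
  qed
  then have "polytime f" by (rule polytimeI)
  then show ?thesis using f f' by blast
qed

section \<open>From graphs to clauses\<close>

definition clause_app :: "nat \<times> nat \<Rightarrow> application_rep" where
  "clause_app e = (0, [Var (fst e), Var (snd e)])"

fun outs :: "bool list \<Rightarrow> com" where
  "outs [] = Skip"
| "outs (b # bs) = Out b ;; outs bs"

lemma exec_outs: "exec K B (outs bs) (r, u, C) (Some (r, u @ bs, C))"
proof (induction bs arbitrary: u)
  case (Cons b bs)
  then show ?case using exec.Seq[OF exec.Out Cons.IH[of "u @ [b]"]] by simp
qed (simp add: exec.Skip)

declare outs.simps [simp del]

text \<open>The printed bits spell the encoding of an application: \<open>True\<close> for a list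
  element, \<open>False\<close> for the constraint index 0, then for each argument
  \<open>True\<close> (element) and \<open>True\<close> (variable), the index in unary and
  \<open>False\<close>; the last \<open>False\<close> ends the argument list. A loop is rejected by
  the middle branch of \<open>compare\<close>.\<close>

definition graph_edge :: com where
  "graph_edge = (read_nat 4 ;; read_nat 5) ;; compare 4 5 Skip Fail Skip ;;
    outs [True, False, True, True] ;; emit 4 ;; outs [False, True, True] ;; emit 5 ;;
    outs [False, False] ;; clear 4 ;; clear 5"

definition graph_clauses :: com where
  "graph_clauses = ((read_nat 3 ;; emit 3 ;; Out False) ;; (read_list graph_edge ;; Out False)) ;;
    ((read_nat 4 ;; compare 3 4 Fail (clear 4) Fail) ;; (read_list graph_edge ;; Out False))"

lemma parses_graph_edge:
  assumes "C = (\<lambda>_. 0)(3 := n)" "n \<le> L" "5 < K"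
  shows "parses K L C graph_edge enc_edge (\<lambda>e. fst e \<noteq> snd e)
    (\<lambda>e. True # enc_app (clause_app e)) (\<lambda>_. C)"
proof -
  let ?D = "\<lambda>(x, y). C(4 := x, 5 := y)"
  have 1: "parses K L C (read_nat 4) enc_nat (\<lambda>_. True) (\<lambda>_. []) (\<lambda>x. C(4 := x))"
    by (rule parses_nat) (use assms in auto)
  have 2: "parses K L (C(4 := x)) (read_nat 5) enc_nat (\<lambda>_. True) (\<lambda>_. [])
      (\<lambda>y. C(4 := x, 5 := y))" for x
    by (rule parses_nat) (use assms in auto)
  from parses_Seq[OF 1 2] have "parses K L C (read_nat 4 ;; read_nat 5)
      (\<lambda>(x, y). enc_nat x @ enc_nat y) (\<lambda>(x, y). True \<and> True) (\<lambda>(x, y). [] @ []) ?D" .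
  then have "parses K L C graph_edge (\<lambda>(x, y). enc_nat x @ enc_nat y)
      (\<lambda>e. (case e of (x, y) \<Rightarrow> True \<and> True) \<and> fst e \<noteq> snd e)
      (\<lambda>e. (case e of (x, y) \<Rightarrow> [] @ []) @ (True # enc_app (clause_app e))) (\<lambda>_. C)"
    unfolding graph_edge_def
  proof (rule parses_then, goal_cases)
    case (1 e r u)
    obtain x y where e: "e = (x, y)" by (cases e)
    have xy: "x \<le> L" "y \<le> L" using 1 e by (auto simp: enc_nat_def)
    let ?C = "C(4 := x, 5 := y)"
    have c: "exec K (L + 2) (compare 4 5 Skip Fail Skip) (r, u, ?C)
        (if x = y then None else Some (r, u, ?C))"
      by (rule exec_compare) (use xy assms in \<open>auto intro: exec.intros\<close>)
    show ?case
    proof (cases "x = y")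
      case True
      then show ?thesis using c e by (auto intro: exec.Seq_None)
    next
      case False
      have e4: "exec K (L + 2) (emit 4) (r, v, ?C) (Some (r, v @ replicate x True, ?C))" for v
        using exec_emit[of ?C 4 K "L + 2" r v] xy assms by simp
      have e5: "exec K (L + 2) (emit 5) (r, v, ?C) (Some (r, v @ replicate y True, ?C))" for v
        using exec_emit[of ?C 5 K "L + 2" r v] xy assms by simp
      have c4: "exec K (L + 2) (clear 4) (r, v, ?C) (Some (r, v, C(5 := y)))" for v
      proof -
        have "?C(4 := 0) = C(5 := y)" using assms by auto
        then show ?thesis using exec_clear[of K "L + 2" 4 r v ?C] by simp
      qed
      have c5: "exec K (L + 2) (clear 5) (r, v, C(5 := y)) (Some (r, v, C))" for v
      proof -
        have "C(5 := y, 5 := 0) = C" using assms by auto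
        then show ?thesis using exec_clear[of K "L + 2" 5 r v "C(5 := y)"] by simp
      qed
      have c': "exec K (L + 2) (compare 4 5 Skip Fail Skip) (r, u, ?C) (Some (r, u, ?C))"
        using c False by simp
      \<comment> \<open>Bracketed to the left, since each command in the chain of
        \<open>exec.Seq\<close> appends to the output so far.\<close>
      have out: "u @ True # enc_app (clause_app (x, y)) = ((((u @ [True, False, True, True]) @
          replicate x True) @ [False, True, True]) @ replicate y True) @ [False, False]"
        by (simp add: enc_app_def clause_app_def enc_list_def enc_nat_def)
      have "exec K (L + 2) (compare 4 5 Skip Fail Skip ;; outs [True, False, True, True] ;; emit 4 ;;
          outs [False, True, True] ;; emit 5 ;; outs [False, False] ;; clear 4 ;; clear 5)
          (r, u, ?C) (Some (r, u @ True # enc_app (clause_app (x, y)), C))"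
        unfolding out
        by (rule exec.Seq[OF c' exec.Seq[OF exec_outs exec.Seq[OF e4 exec.Seq[OF exec_outs
          exec.Seq[OF e5 exec.Seq[OF exec_outs exec.Seq[OF c4 c5]]]]]]])
      then show ?thesis using False e by simp
    qed
  qed
  then show ?thesis
    by (rule parses_cong) (auto simp: enc_edge_def)
qed

definition enc_clauses :: "(nat \<times> nat) list \<Rightarrow> bool list" where
  "enc_clauses es = enc_list enc_app (map clause_app es)"

lemma parses_graph_edges:
  assumes "C = (\<lambda>_. 0)(3 := n)" "n \<le> L" "5 < K"
  shows "parses K L C (read_list graph_edge ;; Out False) (enc_list enc_edge)
    (\<lambda>es. \<forall>e \<in> set es. fst e \<noteq> snd e) enc_clauses (\<lambda>_. C)"
proof -
  have "parses K L C (read_list graph_edge ;; Out False) (enc_list enc_edge)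
    (\<lambda>es. (\<forall>e \<in> set es. fst e \<noteq> snd e) \<and> True)
    (\<lambda>es. concat (map (\<lambda>e. True # enc_app (clause_app e)) es) @ [False]) (\<lambda>_. C)"
    by (rule parses_then[OF parses_list[OF parses_graph_edge[OF assms]]])
      (simp add: exec.Out)
  then show ?thesis
    by (rule parses_cong) (auto simp: enc_clauses_def enc_list_def comp_def)
qed

fun enc_graphs :: "(nat \<times> (nat \<times> nat) list) \<times> (nat \<times> (nat \<times> nat) list) \<Rightarrow> bool list" where
  "enc_graphs (G, H) = enc_graph G @ enc_graph H"

text \<open>An end point outside the vertex set survives the translation as an invalid variable and
  needs no check. Loops do, because x or x is a valid clause, and so do the two vertex numbers,
  because a constraint instance has only one.\<close>

fun loop_free :: "(nat \<times> (nat \<times> nat) list) \<times> (nat \<times> (nat \<times> nat) list) \<Rightarrow> bool" where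
  "loop_free ((n, es), (m, fs)) \<longleftrightarrow>
    (\<forall>e \<in> set es. fst e \<noteq> snd e) \<and> m = n \<and> (\<forall>e \<in> set fs. fst e \<noteq> snd e)"

fun enc_clause_sets :: "(nat \<times> (nat \<times> nat) list) \<times> (nat \<times> (nat \<times> nat) list) \<Rightarrow> bool list" where
  "enc_clause_sets ((n, es), (m, fs)) = enc_iso n (map clause_app es) (map clause_app fs)"

lemma parses_graph_clauses:
  assumes "5 < K"
  shows "parses K L (\<lambda>_. 0) graph_clauses enc_graphs loop_free enc_clause_sets
    (\<lambda>((n, _), _). (\<lambda>_. 0)(3 := n))"
proof -
  let ?C = "\<lambda>n. (\<lambda>_. 0)(3 := n)"
  have 1: "parses K L (\<lambda>_. 0) (read_nat 3) enc_nat (\<lambda>_. True) (\<lambda>_. []) ?C"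
    by (rule parses_nat) (use assms in auto)
  have 2: "parses K L (\<lambda>_. 0) (read_nat 3 ;; emit 3 ;; Out False) enc_nat
      (\<lambda>n. True \<and> True) (\<lambda>n. [] @ enc_nat n) ?C"
  proof (rule parses_then[OF 1])
    fix n :: nat and r u assume "length (enc_nat n) \<le> L"
    then have "exec K (L + 2) (emit 3) (r, u, ?C n) (Some (r, u @ replicate n True, ?C n))"
      using exec_emit[of "?C n" 3 K "L + 2" r u] assms by (simp add: enc_nat_def)
    from exec.Seq[OF this exec.Out]
    show "exec K (L + 2) (emit 3 ;; Out False) (r, u, ?C n)
        (if True then Some (r, u @ enc_nat n, ?C n) else None)"
      by (simp add: enc_nat_def)
  qed
  have 3: "parses K L (?C n) (read_nat 4) enc_nat (\<lambda>_. True) (\<lambda>_. [])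
      (\<lambda>m. (?C n)(4 := m))" for n
    by (rule parses_nat) (use assms in auto)
  have 4: "parses K L (?C n) (read_nat 4 ;; compare 3 4 Fail (clear 4) Fail) enc_nat
      (\<lambda>m. True \<and> m = n) (\<lambda>m. [] @ []) (\<lambda>_. ?C n)" if "n \<le> L" for n
  proof (rule parses_then[OF 3])
    fix m :: nat and r :: "bool list" and u
    assume "length (enc_nat m) \<le> L"
    moreover have "((\<lambda>_. 0)(3 := n))(4 := m, 4 := 0) = (\<lambda>_ :: nat. 0 :: nat)(3 := n)" by auto
    then have "exec K (L + 2) (clear 4) (r, u, (?C n)(4 := m)) (Some (r, u, ?C n))"
      using exec_clear[of K "L + 2" 4 r u "(?C n)(4 := m)"] by simp
    ultimately show "exec K (L + 2) (compare 3 4 Fail (clear 4) Fail) (r, u, (?C n)(4 := m))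
        (if m = n then Some (r, u @ [], ?C n) else None)"
      using assms that by (intro exec_compare) (auto simp: enc_nat_def intro: exec.Fail)
  qed
  note edges = parses_graph_edges[OF refl _ assms]
  have 5: "parses K L (\<lambda>_. 0) ((read_nat 3 ;; emit 3 ;; Out False) ;; (read_list graph_edge ;; Out False))
      (\<lambda>(n, es). enc_nat n @ enc_list enc_edge es)
      (\<lambda>(n, es). (True \<and> True) \<and> (\<forall>e \<in> set es. fst e \<noteq> snd e))
      (\<lambda>(n, es). ([] @ enc_nat n) @ enc_clauses es) (\<lambda>(n, es). ?C n)"
    by (rule parses_Seq[OF 2 edges]) (simp add: enc_nat_def)
  have 6: "parses K L (?C n) ((read_nat 4 ;; compare 3 4 Fail (clear 4) Fail) ;;
        (read_list graph_edge ;; Out False))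
      (\<lambda>(m, es). enc_nat m @ enc_list enc_edge es)
      (\<lambda>(m, es). (True \<and> m = n) \<and> (\<forall>e \<in> set es. fst e \<noteq> snd e))
      (\<lambda>(m, es). ([] @ []) @ enc_clauses es) (\<lambda>(m, es). ?C n)" if "n \<le> L" for n
    by (rule parses_Seq[OF 4[OF that] edges]) (use that in auto)
  have 7: "parses K L (case G of (n, es) \<Rightarrow> ?C n) ((read_nat 4 ;; compare 3 4 Fail (clear 4) Fail) ;;
        (read_list graph_edge ;; Out False))
      (\<lambda>(m, es). enc_nat m @ enc_list enc_edge es)
      (\<lambda>(m, es). (True \<and> m = fst G) \<and> (\<forall>e \<in> set es. fst e \<noteq> snd e))
      (\<lambda>(m, es). ([] @ []) @ enc_clauses es) (\<lambda>_. ?C (fst G))"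
    if "length (case G of (n, es) \<Rightarrow> enc_nat n @ enc_list enc_edge es) \<le> L" for G
    using 6[of "fst G"] that by (cases G) (simp add: enc_nat_def split_def)
  show ?thesis
    unfolding graph_clauses_def
    by (rule parses_cong[OF parses_Seq[OF 5 7]])
      (auto simp: enc_graph_def enc_iso_def enc_clauses_def split_def, fastforce+)
qed

section \<open>From clauses to graphs\<close>

text \<open>With \<open>m = n + 2\<close> these are the edges forced by the unit clause x_a: all
  pairs with \<open>a\<close>, fresh vertices included.\<close>

definition star :: "nat \<Rightarrow> nat \<Rightarrow> (nat \<times> nat) list" where
  "star m a = map (Pair a) (filter (\<lambda>j. j \<noteq> a) [0..<m])"

definition enc_edges :: "(nat \<times> nat) list \<Rightarrow> bool list" where
  "enc_edges es = concat (map (\<lambda>e. True # enc_edge e) es)"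

text \<open>A variable is represented by its index, the constant 0 by \<open>n\<close> and the constant 1 by \<open>n + 1\<close>.\<close>

fun arg_code :: "nat \<Rightarrow> arg \<Rightarrow> nat" where
  "arg_code n (Var x) = x"
| "arg_code n (Const b) = (if b then n + 1 else n)"

fun valid_arg :: "bool \<Rightarrow> nat \<Rightarrow> arg \<Rightarrow> bool" where
  "valid_arg c n (Var x) \<longleftrightarrow> x < n"
| "valid_arg c n (Const b) \<longleftrightarrow> c"

text \<open>Since \<open>x \<or> 0\<close> means \<open>x \<or> x\<close>, a constant 0 is first replaced by the other argument.\<close>

definition code_edges :: "nat \<Rightarrow> nat \<Rightarrow> nat \<Rightarrow> (nat \<times> nat) list" where
  "code_edges n a b = (let a' = (if a = n then b else a); b' = (if b = n then a' else b) in
    if a' < n \<and> b' < n then if a' = b' then star (n + 2) a' else [(a', b')]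
    else if a' = n then concat (map (star (n + 2)) [0..<n + 2])
    else [])"

definition edge_out :: "nat \<Rightarrow> nat \<Rightarrow> com" where
  "edge_out i j = Out True ;; emit i ;; Out False ;; emit j ;; Out False"

text \<open>Counter 4 holds n + 2; 8 runs through the vertices and 7 counts the rounds left. Both
  outer branches print, and the middle one skips the loop.\<close>

definition star_out :: "nat \<Rightarrow> com" where
  "star_out i = count_up 4 7 8 (compare 8 i (edge_out i 8) Skip (edge_out i 8))"

text \<open>The complete graph, for the clause 0 or 0. Counter 5 holds the code n at this point and
  is cleared because it becomes the outer loop variable.\<close>

definition stars_out :: com where
  "stars_out = clear 5 ;; count_up 4 9 5 (star_out 5)"

text \<open>Comparison with counter 3, which holds n, tells variables (smaller), 0 (equal) and 1
  (greater) apart. After the two replacements, counter 5 equals n only for 0 or 0.\<close>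

definition clause_out :: com where
  "clause_out =
    compare 5 3 Skip (clear 5 ;; copy 6 5) Skip ;;
    compare 6 3 Skip (clear 6 ;; copy 5 6) Skip ;;
    compare 5 3
      (compare 6 3 (compare 5 6 (edge_out 5 6) (star_out 5) (edge_out 5 6)) Skip Skip)
      stars_out Skip ;;
    clear 5 ;; clear 6"

definition read_arg :: "bool \<Rightarrow> nat \<Rightarrow> com" where
  "read_arg c i = If (Sees (Some True))
    (Read ;; read_nat i ;; compare i 3 Skip Fail Fail)
    (expect False ;; If (Sees (Some True))
      (Read ;; (if c then copy 3 i ;; Inc i else Fail))
      (expect False ;; (if c then copy 3 i else Fail)))"

text \<open>The expected bits enforce the constraint index 0 and exactly two arguments.\<close>

definition read_clause :: "bool \<Rightarrow> com" where
  "read_clause c = ((expect False ;;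
    ((expect True ;; read_arg c 5) ;; (expect True ;; read_arg c 6))) ;; expect False) ;; clause_out"

definition clause_graphs :: "bool \<Rightarrow> com" where
  "clause_graphs c =
    (read_nat 3 ;; (copy 3 4 ;; Inc 4 ;; Inc 4 ;; emit 4 ;; Out False)) ;;
    ((read_list (read_clause c) ;; (Out False ;; emit 4 ;; Out False)) ;;
     (read_list (read_clause c) ;; Out False))"

section \<open>Execution of the edge-printing programs\<close>

lemma exec_edge_out:
  assumes "C 0 = 0" "i \<noteq> 0" "i < K" "C i \<le> B" "j \<noteq> 0" "j < K" "C j \<le> B"
  shows "exec K B (edge_out i j) (r, u, C) (Some (r, u @ True # enc_edge (C i, C j), C))"
proof -
  have out: "u @ True # enc_edge (C i, C j) =
      (((((u @ [True]) @ replicate (C i) True) @ [False]) @ replicate (C j) True) @ [False])"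
    by (simp add: enc_edge_def enc_nat_def)
  note i = exec_emit[of C, OF assms(1-4)] and j = exec_emit[of C, OF assms(1,5-7)]
  show ?thesis
    unfolding edge_out_def out
    by (rule exec.Seq[OF exec.Out exec.Seq[OF i exec.Seq[OF exec.Out exec.Seq[OF j exec.Out]]]])
qed

lemma enc_edges_star:
  "enc_edges (star m a) =
    concat (map (\<lambda>j. if j = a then [] else True # enc_edge (a, j)) [0..<m])"
proof -
  have "enc_edges (map (Pair a) (filter (\<lambda>j. j \<noteq> a) xs)) =
      concat (map (\<lambda>j. if j = a then [] else True # enc_edge (a, j)) xs)" for xs
    by (induction xs) (auto simp: enc_edges_def)
  then show ?thesis by (simp add: star_def)
qed

lemma enc_edges_concat: "enc_edges (concat ess) = concat (map enc_edges ess)"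
  by (induction ess) (auto simp: enc_edges_def)

lemma exec_star_out:
  assumes "C 0 = 0" "C 1 = 0" "C 2 = 0" "C 7 = 0" "C 8 = 0" "2 < i" "i < 7" "i \<noteq> 4" "8 < K"
    "C 4 \<le> B" "C i \<le> B"
  shows "exec K B (star_out i) (r, u, C) (Some (r, u @ enc_edges (star (C 4) (C i)), C))"
  unfolding star_out_def enc_edges_star
proof (rule exec_count_up)
  fix l v assume l: "l < C 4"
  let ?C = "C(8 := l, 7 := C 4 - l)"
  have "?C 0 = 0" "?C 8 = l" "?C i = C i" using assms by auto
  then have e: "exec K B (edge_out i 8) (r, v, ?C) (Some (r, v @ True # enc_edge (C i, l), ?C))"
    using exec_edge_out[of ?C i K B 8 r v] assms l by simp
  show "exec K B (compare 8 i (edge_out i 8) Skip (edge_out i 8)) (r, v, ?C)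
      (Some (r, v @ (if l = C i then [] else True # enc_edge (C i, l)), ?C))"
  proof (rule exec_compare)
    show "exec K B (if ?C 8 < ?C i then edge_out i 8 else if ?C 8 = ?C i then Skip else edge_out i 8)
        (r, v, ?C) (Some (r, v @ (if l = C i then [] else True # enc_edge (C i, l)), ?C))"
      using e \<open>?C 8 = l\<close> \<open>?C i = C i\<close>
      by (auto simp del: fun_upd_apply intro: exec.Skip)
  qed (use assms l in auto)
qed (use assms in auto)

lemma exec_stars_out:
  assumes "C 0 = 0" "C 1 = 0" "C 2 = 0" "C 7 = 0" "C 8 = 0" "C 9 = 0" "9 < K" "C 4 \<le> B"
  shows "exec K B stars_out (r, u, C)
    (Some (r, u @ enc_edges (concat (map (star (C 4)) [0..<C 4])), C(5 := 0)))"
  unfolding stars_out_def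
proof (rule exec.Seq[OF exec_clear])
  let ?C = "C(5 := 0)"
  have "exec K B (count_up 4 9 5 (star_out 5)) (r, u, ?C)
      (Some (r, u @ concat (map (\<lambda>a. enc_edges (star (C 4) a)) [0..<?C 4]), ?C))"
  proof (rule exec_count_up)
    fix l v assume l: "l < ?C 4"
    let ?D = "?C(5 := l, 9 := ?C 4 - l)"
    show "exec K B (star_out 5) (r, v, ?D) (Some (r, v @ enc_edges (star (C 4) l), ?D))"
      using exec_star_out[of ?D 5 K B r v] assms l by simp
  qed (use assms in auto)
  then show "exec K B (count_up 4 9 5 (star_out 5)) (r, u, ?C)
      (Some (r, u @ enc_edges (concat (map (star (C 4)) [0..<C 4])), ?C))"
    by (simp add: enc_edges_concat comp_def)
qed

definition counters :: "nat \<Rightarrow> nat \<Rightarrow> nat \<Rightarrow> nat \<Rightarrow> nat" where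
  "counters n a b = (\<lambda>_. 0)(3 := n, 4 := n + 2, 5 := a, 6 := b)"

lemma counters_simps [simp]:
  "counters n a b 0 = 0" "counters n a b 1 = 0" "counters n a b (Suc 0) = 0"
  "counters n a b 2 = 0" "counters n a b 3 = n" "counters n a b 4 = n + 2"
  "counters n a b 5 = a" "counters n a b 6 = b" "counters n a b 7 = 0" "counters n a b 8 = 0"
  "counters n a b 9 = 0"
  "(counters n a b)(5 := c) = counters n c b" "(counters n a b)(6 := c) = counters n a c"
  by (auto simp: counters_def)

lemma exec_clause_out:
  assumes "n \<le> L" "a \<le> n + 1" "b \<le> n + 1" "9 < K"
  shows "exec K (L + 2) clause_out (r, u, counters n a b)
    (Some (r, u @ enc_edges (code_edges n a b), counters n 0 0))"
proof -
  define a' where "a' = (if a = n then b else a)"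
  define b' where "b' = (if b = n then a' else b)"
  have le: "a' \<le> n + 1" "b' \<le> n + 1" using assms by (auto simp: a'_def b'_def)
  have clear: "exec K (L + 2) (clear 5) (r, v, counters n x y) (Some (r, v, counters n 0 y))"
    "exec K (L + 2) (clear 6) (r, v, counters n x y) (Some (r, v, counters n x 0))" for v x y
    using exec_clear[of K "L + 2" 5 r v "counters n x y"]
      exec_clear[of K "L + 2" 6 r v "counters n x y"] by auto
  have copy: "exec K (L + 2) (copy 6 5) (r, v, counters n 0 y) (Some (r, v, counters n y y))"
    "exec K (L + 2) (copy 5 6) (r, v, counters n y 0) (Some (r, v, counters n y y))"
    if "y \<le> n + 1" for v y
    using exec_copy[of "counters n 0 y" 6 5 K "L + 2" r v]
      exec_copy[of "counters n y 0" 5 6 K "L + 2" r v] assms that by auto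
  have 1: "exec K (L + 2) (compare 5 3 Skip (clear 5 ;; copy 6 5) Skip) (r, v, counters n a b)
      (Some (r, v, counters n a' b))" for v
    using assms exec.Seq[OF clear(1) copy(1)]
    by (intro exec_compare) (auto simp: a'_def intro: exec.Skip)
  have 2: "exec K (L + 2) (compare 6 3 Skip (clear 6 ;; copy 5 6) Skip) (r, v, counters n a' b)
      (Some (r, v, counters n a' b'))" for v
    using assms exec.Seq[OF clear(2) copy(2)] le
    by (intro exec_compare) (auto simp: b'_def intro: exec.Skip)
  \<comment> \<open>Counter 5 is left unspecified: \<open>stars_out\<close> resets it and the other
    branches do not, and it is cleared next anyway.\<close>
  have "\<exists>x. exec K (L + 2) (compare 5 3
      (compare 6 3 (compare 5 6 (edge_out 5 6) (star_out 5) (edge_out 5 6)) Skip Skip)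
      stars_out Skip) (r, u, counters n a' b')
      (Some (r, u @ enc_edges (code_edges n a b), counters n x b'))"
  proof (cases "a' < n")
    case True
    have code: "code_edges n a b = (if b' < n then if a' = b' then star (n + 2) a' else [(a', b')] else [])"
      using True by (auto simp: code_edges_def Let_def a'_def b'_def)
    have e: "exec K (L + 2) (edge_out 5 6) (r, u, counters n a' b')
        (Some (r, u @ enc_edges [(a', b')], counters n a' b'))"
      using exec_edge_out[of "counters n a' b'" 5 K "L + 2" 6 r u] assms le by (simp add: enc_edges_def)
    have s: "exec K (L + 2) (star_out 5) (r, u, counters n a' b')
        (Some (r, u @ enc_edges (star (n + 2) a'), counters n a' b'))"
      using exec_star_out[of "counters n a' b'" 5 K "L + 2" r u] assms le by simp
    have 3: "exec K (L + 2) (compare 5 6 (edge_out 5 6) (star_out 5) (edge_out 5 6)) (r, u, counters n a' b')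
        (Some (r, u @ enc_edges (if a' = b' then star (n + 2) a' else [(a', b')]), counters n a' b'))"
      using e s assms le by (intro exec_compare) auto
    have 4: "exec K (L + 2) Skip (r, u, counters n a' b') (Some (r, u @ enc_edges [], counters n a' b'))"
      using exec.Skip by (simp add: enc_edges_def)
    have "exec K (L + 2) (compare 6 3 (compare 5 6 (edge_out 5 6) (star_out 5) (edge_out 5 6)) Skip Skip)
        (r, u, counters n a' b') (Some (r, u @ enc_edges (code_edges n a b), counters n a' b'))"
      unfolding code using 3 4 assms le by (intro exec_compare) auto
    then show ?thesis
      using True assms le by (intro exI[of _ a'] exec_compare) auto
  next
    case False
    show ?thesis
    proof (cases "a' = n")
      case True
      then have code: "code_edges n a b = concat (map (star (n + 2)) [0..<n + 2])"
        by (auto simp: code_edges_def Let_def a'_def)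
      have "exec K (L + 2) stars_out (r, u, counters n a' b')
          (Some (r, u @ enc_edges (code_edges n a b), counters n 0 b'))"
        using exec_stars_out[of "counters n a' b'" K "L + 2" r u] assms unfolding code by simp
      then show ?thesis using True assms le by (intro exI[of _ 0] exec_compare) auto
    next
      case False
      then have "code_edges n a b = []"
        using \<open>\<not> a' < n\<close> by (auto simp: code_edges_def Let_def a'_def)
      then show ?thesis using False \<open>\<not> a' < n\<close> assms le
        by (intro exI[of _ a'] exec_compare) (auto simp: enc_edges_def intro: exec.Skip)
    qed
  qed
  then obtain x where 3: "exec K (L + 2) (compare 5 3
      (compare 6 3 (compare 5 6 (edge_out 5 6) (star_out 5) (edge_out 5 6)) Skip Skip)
      stars_out Skip) (r, u, counters n a' b')
      (Some (r, u @ enc_edges (code_edges n a b), counters n x b'))"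
    by blast
  show ?thesis
    unfolding clause_out_def
    by (rule exec.Seq[OF 1 exec.Seq[OF 2 exec.Seq[OF 3 exec.Seq[OF clear]]]])
qed

section \<open>Parsing arguments and clauses\<close>

lemma parses_arg:
  assumes "C 0 = 0" "C 1 = 0" "C 2 = 0" "C 3 = n" "C i = 0" "3 < i" "i < K" "n \<le> L"
  shows "parses K L C (read_arg c i) enc_arg (valid_arg c n) (\<lambda>_. []) (\<lambda>a. C(i := arg_code n a))"
proof -
  have nat: "parses K L C (read_nat i ;; compare i 3 Skip Fail Fail) enc_nat
      (\<lambda>x. True \<and> x < n) (\<lambda>_. [] @ []) (\<lambda>x. C(i := x))"
  proof (rule parses_then[OF parses_nat])
    fix x :: nat and r :: "bool list" and u
    assume "length (enc_nat x) \<le> L"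
    then show "exec K (L + 2) (compare i 3 Skip Fail Fail) (r, u, C(i := x))
        (if x < n then Some (r, u @ [], C(i := x)) else None)"
      using assms by (intro exec_compare) (auto simp: enc_nat_def intro: exec.Skip exec.Fail)
  qed (use assms in auto)
  have copy: "exec K (L + 2) (copy 3 i) (r, u, C) (Some (r, u, C(i := n)))" for r u
    using exec_copy[of C 3 i K "L + 2" r u] assms by simp
  have inc: "exec K (L + 2) (Inc i) (r, u, C(i := n)) (Some (r, u, C(i := n + 1)))" for r u
    using exec.Inc[of i K "C(i := n)" "L + 2" r u] assms by simp
  show ?thesis
  proof (rule parsesI, goal_cases)
    case (1 a r u)
    show ?case
    proof (cases a)
      case (Var x)
      then have "exec K (L + 2) (read_nat i ;; compare i 3 Skip Fail Fail) (enc_nat x @ r, u, C)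
          (Some (r, u @ [] @ [], C(i := x)))"
        using 1 by (intro parses_Some[OF nat]) auto
      from exec.Seq[OF exec.Read this] show ?thesis
        unfolding read_arg_def using Var by (intro exec.If_True) auto
    next
      case (Const b)
      then have c: c using 1 by simp
      show ?thesis
      proof (cases b)
        case True
        have "exec K (L + 2) (If (Sees (Some True)) (Read ;; (if c then copy 3 i ;; Inc i else Fail))
            (expect False ;; (if c then copy 3 i else Fail))) (True # r, u, C)
            (Some (r, u, C(i := n + 1)))"
          using c exec.Seq[OF exec.Read exec.Seq[OF copy inc]] by (intro exec.If_True) auto
        from exec.Seq[OF exec_expect this] show ?thesis
          unfolding read_arg_def using Const True by (intro exec.If_False) auto
      next
        case False
        have "exec K (L + 2) (If (Sees (Some True)) (Read ;; (if c then copy 3 i ;; Inc i else Fail))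
            (expect False ;; (if c then copy 3 i else Fail))) (False # r, u, C)
            (Some (r, u, C(i := n)))"
          using c exec.Seq[OF exec_expect copy] by (intro exec.If_False) auto
        from exec.Seq[OF exec_expect this] show ?thesis
          unfolding read_arg_def using Const False by (intro exec.If_False) auto
      qed
    qed
  next
    case (2 w u)
    show ?case
    proof (cases "peek w = Some True")
      case True
      then obtain w' where w: "w = True # w'" by (cases w) auto
      have "\<not> x < n" if "w' = enc_nat x @ r" for x r
        using 2(2)[of "Var x" r] w that by simp
      then have "exec K (L + 2) (read_nat i ;; compare i 3 Skip Fail Fail) (w', u, C) None"
        using 2 w by (intro parses_None[OF nat]) auto
      from exec.Seq[OF exec.Read this] show ?thesis
        unfolding read_arg_def using w by (intro exec.If_True) auto
    next
      case False
      show ?thesis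
      proof (cases "peek w = Some False")
        case True
        then obtain w' where w: "w = False # w'" by (cases w) auto
        have "exec K (L + 2) (If (Sees (Some True)) (Read ;; (if c then copy 3 i ;; Inc i else Fail))
            (expect False ;; (if c then copy 3 i else Fail))) (w', u, C) None"
        proof (cases w')
          case Nil
          then show ?thesis by (intro exec.If_False exec.Seq_None exec_expect_None) auto
        next
          case (Cons b r)
          then have c: "\<not> c" using 2(2)[of "Const b" r] w by auto
          show ?thesis
          proof (cases b)
            case True
            then show ?thesis using c Cons exec.Seq[OF exec.Read exec.Fail]
              by (intro exec.If_True) auto
          next
            case False
            then show ?thesis using c Cons exec.Seq[OF exec_expect exec.Fail]
              by (intro exec.If_False) auto
          qed
        qed
        from exec.Seq[OF exec_expect this] show ?thesis
          unfolding read_arg_def using w by (intro exec.If_False) auto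
      next
        assume "peek w \<noteq> Some False"
        then show ?thesis
          unfolding read_arg_def using False
          by (intro exec.If_False exec.Seq_None exec_expect_None) auto
      qed
    qed
  qed
qed

fun pair_app :: "arg \<times> arg \<Rightarrow> application_rep" where
  "pair_app (a, b) = (0, [a, b])"

fun valid_pair :: "bool \<Rightarrow> nat \<Rightarrow> arg \<times> arg \<Rightarrow> bool" where
  "valid_pair c n (a, b) \<longleftrightarrow> valid_arg c n a \<and> valid_arg c n b"

fun pair_edges :: "nat \<Rightarrow> arg \<times> arg \<Rightarrow> (nat \<times> nat) list" where
  "pair_edges n (a, b) = code_edges n (arg_code n a) (arg_code n b)"

lemma arg_code_le: "valid_arg c n a \<Longrightarrow> arg_code n a \<le> n + 1"
  by (cases a) auto

lemma parses_clause:
  assumes "n \<le> L" "9 < K"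
  shows "parses K L (counters n 0 0) (read_clause c) (\<lambda>p. enc_app (pair_app p)) (valid_pair c n)
    (\<lambda>p. enc_edges (pair_edges n p)) (\<lambda>_. counters n 0 0)"
proof -
  have 1: "parses K L (counters n 0 0) (expect True ;; read_arg c 5) (\<lambda>a. True # enc_arg a)
      (valid_arg c n) (\<lambda>_. []) (\<lambda>a. counters n (arg_code n a) 0)"
    using parses_expect[OF parses_arg[of "counters n 0 0" n 5]] assms by simp
  have 2: "parses K L (counters n x 0) (expect True ;; read_arg c 6) (\<lambda>a. True # enc_arg a)
      (valid_arg c n) (\<lambda>_. []) (\<lambda>b. counters n x (arg_code n b))" for x
    using parses_expect[OF parses_arg[of "counters n x 0" n 6]] assms by simp
  note 3 = parses_expect_last[OF parses_expect[OF parses_Seq[OF 1 2]], of False False]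
  have "parses K L (counters n 0 0) (read_clause c)
      (\<lambda>p. (False # (case p of (x, y) \<Rightarrow> (True # enc_arg x) @ True # enc_arg y)) @ [False])
      (\<lambda>p. (case p of (x, y) \<Rightarrow> valid_arg c n x \<and> valid_arg c n y) \<and> True)
      (\<lambda>p. (case p of (x, y) \<Rightarrow> [] @ []) @ enc_edges (pair_edges n p)) (\<lambda>_. counters n 0 0)"
    unfolding read_clause_def
  proof (rule parses_then[OF 3], goal_cases)
    case (1 p r u)
    obtain a b where p: "p = (a, b)" by (cases p)
    have "arg_code n a \<le> n + 1" "arg_code n b \<le> n + 1"
      using 1 p by (auto intro: arg_code_le[unfolded Suc_eq_plus1[symmetric]])
    then show ?case
      using exec_clause_out[of n L "arg_code n a" "arg_code n b" K r u] p assms by simp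
  qed
  then show ?thesis
    by (rule parses_cong) (auto simp: enc_app_def enc_nat_def enc_list_def)
qed

section \<open>The complete clause-to-graph program\<close>

definition clause_graph :: "nat \<Rightarrow> (arg \<times> arg) list \<Rightarrow> nat \<times> (nat \<times> nat) list" where
  "clause_graph n ps = (n + 2, concat (map (pair_edges n) ps))"

fun enc_pairs :: "nat \<times> (arg \<times> arg) list \<times> (arg \<times> arg) list \<Rightarrow> bool list" where
  "enc_pairs (n, ps, qs) = enc_iso n (map pair_app ps) (map pair_app qs)"

fun valid_pairs :: "bool \<Rightarrow> nat \<times> (arg \<times> arg) list \<times> (arg \<times> arg) list \<Rightarrow> bool" where
  "valid_pairs c (n, ps, qs) \<longleftrightarrow> (\<forall>p \<in> set ps. valid_pair c n p) \<and> (\<forall>p \<in> set qs. valid_pair c n p)"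

fun enc_clause_graphs :: "nat \<times> (arg \<times> arg) list \<times> (arg \<times> arg) list \<Rightarrow> bool list" where
  "enc_clause_graphs (n, ps, qs) = enc_graph (clause_graph n ps) @ enc_graph (clause_graph n qs)"

lemma parses_clause_graphs:
  assumes "9 < K"
  shows "parses K L (\<lambda>_. 0) (clause_graphs c) enc_pairs (valid_pairs c) enc_clause_graphs
    (\<lambda>(n, _). counters n 0 0)"
proof -
  let ?C = "\<lambda>n. counters n 0 0"
  have emit: "exec K (L + 2) (emit 4 ;; Out False) (r, u, ?C n) (Some (r, u @ enc_nat (n + 2), ?C n))"
    if "n \<le> L" for r u n
  proof -
    have "exec K (L + 2) (emit 4) (r, u, ?C n) (Some (r, u @ replicate (n + 2) True, ?C n))"
      using exec_emit[of "?C n" 4 K "L + 2" r u] assms that by simp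
    from exec.Seq[OF this exec.Out] show ?thesis by (simp add: enc_nat_def)
  qed
  have 1: "parses K L (\<lambda>_. 0) (read_nat 3 ;; (copy 3 4 ;; Inc 4 ;; Inc 4 ;; emit 4 ;; Out False)) enc_nat
      (\<lambda>n. True \<and> True) (\<lambda>n. [] @ enc_nat (n + 2)) ?C"
  proof (rule parses_then[OF parses_nat])
    fix n :: nat and r u assume "length (enc_nat n) \<le> L"
    then have n: "n + 1 \<le> L" by (simp add: enc_nat_def)
    let ?D = "\<lambda>m. (\<lambda>_ :: nat. 0 :: nat)(3 := n, 4 := m)"
    have "?D 0 = (\<lambda>_. 0)(3 := n)" by auto
    then have a: "exec K (L + 2) (copy 3 4) (r, u, (\<lambda>_. 0)(3 := n)) (Some (r, u, ?D n))"
      using exec_copy[of "?D 0" 3 4 K "L + 2" r u] assms n by simp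
    have b: "exec K (L + 2) (Inc 4) (r, u, ?D m) (Some (r, u, ?D (Suc m)))" if "m < L + 2" for m
      using exec.Inc[of 4 K "?D m" "L + 2" r u] assms that by simp
    have "?D (Suc (Suc n)) = ?C n" by (auto simp: counters_def)
    then have "exec K (L + 2) (copy 3 4 ;; Inc 4 ;; Inc 4 ;; emit 4 ;; Out False)
        (r, u, (\<lambda>_. 0)(3 := n)) (Some (r, u @ enc_nat (n + 2), ?C n))"
      using emit[of n r u] n by (intro exec.Seq[OF a exec.Seq[OF b exec.Seq[OF b]]]) auto
    then show "exec K (L + 2) (copy 3 4 ;; Inc 4 ;; Inc 4 ;; emit 4 ;; Out False)
        (r, u, (\<lambda>_. 0)(3 := n)) (if True then Some (r, u @ enc_nat (n + 2), ?C n) else None)"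
      by simp
  qed (use assms in auto)
  have 2: "parses K L (?C n) (read_list (read_clause c) ;; (Out False ;; emit 4 ;; Out False))
      (enc_list (\<lambda>p. enc_app (pair_app p))) (\<lambda>ps. (\<forall>p \<in> set ps. valid_pair c n p) \<and> True)
      (\<lambda>ps. concat (map (\<lambda>p. enc_edges (pair_edges n p)) ps) @ False # enc_nat (n + 2))
      (\<lambda>_. ?C n)" if "n \<le> L" for n
  proof (rule parses_then[OF parses_list[OF parses_clause[OF that assms]]])
    fix r u
    show "exec K (L + 2) (Out False ;; emit 4 ;; Out False) (r, u, ?C n)
        (if True then Some (r, u @ False # enc_nat (n + 2), ?C n) else None)"
      using exec.Seq[OF exec.Out emit[OF that]] by simp
  qed
  have 3: "parses K L (?C n) (read_list (read_clause c) ;; Out False)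
      (enc_list (\<lambda>p. enc_app (pair_app p))) (\<lambda>ps. (\<forall>p \<in> set ps. valid_pair c n p) \<and> True)
      (\<lambda>ps. concat (map (\<lambda>p. enc_edges (pair_edges n p)) ps) @ [False])
      (\<lambda>_. ?C n)" if "n \<le> L" for n
    by (rule parses_then[OF parses_list[OF parses_clause[OF that assms]]])
      (simp add: exec.Out)
  have 4: "parses K L (?C n)
      ((read_list (read_clause c) ;; (Out False ;; emit 4 ;; Out False)) ;;
        (read_list (read_clause c) ;; Out False))
      (\<lambda>(ps, qs). enc_list (\<lambda>p. enc_app (pair_app p)) ps @ enc_list (\<lambda>p. enc_app (pair_app p)) qs)
      (\<lambda>(ps, qs). ((\<forall>p \<in> set ps. valid_pair c n p) \<and> True) \<and>
        (\<forall>p \<in> set qs. valid_pair c n p) \<and> True)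
      (\<lambda>(ps, qs). (concat (map (\<lambda>p. enc_edges (pair_edges n p)) ps) @ False # enc_nat (n + 2)) @
        concat (map (\<lambda>p. enc_edges (pair_edges n p)) qs) @ [False])
      (\<lambda>(ps, qs). ?C n)" if "length (enc_nat n) \<le> L" for n
  proof -
    have "n \<le> L" using that by (simp add: enc_nat_def)
    from parses_Seq[OF 2[OF this] 3[OF this]] show ?thesis .
  qed
  have edges: "enc_list enc_edge (concat (map (pair_edges n) ps)) =
      concat (map (\<lambda>p. enc_edges (pair_edges n p)) ps) @ [False]" for n ps
    using enc_edges_concat[of "map (pair_edges n) ps"]
    by (simp add: enc_list_def enc_edges_def comp_def)
  have apps: "enc_list enc_app (map pair_app ps) = enc_list (\<lambda>p. enc_app (pair_app p)) ps" for ps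
    by (simp add: enc_list_def comp_def)
  show ?thesis
    unfolding clause_graphs_def
    by (rule parses_cong[OF parses_Seq[OF 1 4]])
      (auto simp del: valid_pair.simps simp: enc_graph_def clause_graph_def enc_iso_def edges apps)
qed

section \<open>Isomorphism of sets of clauses\<close>

definition sat :: "(arg \<times> arg) set \<Rightarrow> (nat \<Rightarrow> bool) \<Rightarrow> bool" where
  "sat S \<alpha> \<longleftrightarrow> (\<forall>(a, b) \<in> S. arg_val \<alpha> a \<or> arg_val \<alpha> b)"

abbreviation or_constraint :: constraint where
  "or_constraint \<equiv> {[False, True], [True, False], [True, True]}"

lemma satisfies_pairs: "satisfies \<alpha> (apps_of [or_constraint] (map pair_app ps)) \<longleftrightarrow> sat (set ps) \<alpha>"
proof -
  have or: "[x, y] \<in> or_constraint \<longleftrightarrow> x \<or> y" for x y by auto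
  have "satisfies \<alpha> (apps_of [or_constraint] (map pair_app ps)) \<longleftrightarrow>
      (\<forall>(a, b) \<in> set ps. [arg_val \<alpha> a, arg_val \<alpha> b] \<in> or_constraint)"
    unfolding satisfies_def apps_of_def
    by (simp add: image_image split_beta del: insert_iff) (auto simp del: insert_iff)
  then show ?thesis unfolding or sat_def .
qed

lemma arg_val_rename: "arg_val \<alpha> (rename_arg \<pi> a) = arg_val (\<alpha> \<circ> \<pi>) a"
  by (cases a) auto

lemma satisfies_rename: "satisfies \<alpha> (rename \<pi> S) \<longleftrightarrow> satisfies (\<alpha> \<circ> \<pi>) S"
  by (simp add: satisfies_def rename_def split_beta comp_def arg_val_rename[unfolded comp_def])

definition clauses_isomorphic :: "nat \<Rightarrow> (arg \<times> arg) set \<Rightarrow> (arg \<times> arg) set \<Rightarrow> bool" where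
  "clauses_isomorphic n S U \<longleftrightarrow> (\<exists>\<pi>. \<pi> permutes {..<n} \<and> (\<forall>\<alpha>. sat S (\<alpha> \<circ> \<pi>) \<longleftrightarrow> sat U \<alpha>))"

lemma isomorphic_over_pairs:
  "isomorphic_over {..<n} (apps_of [or_constraint] (map pair_app ps))
     (apps_of [or_constraint] (map pair_app qs)) \<longleftrightarrow> clauses_isomorphic n (set ps) (set qs)"
  unfolding isomorphic_over_def equivalent_def clauses_isomorphic_def satisfies_rename
    satisfies_pairs ..

text \<open>Clauses contain no negations, and valid ones mention only variables below
  \<open>n\<close>, so comparing the assignments there suffices. In particular the values at fresh
  indices are irrelevant.\<close>

lemma sat_mono:
  assumes "sat S \<alpha>" "\<And>x. x < n \<Longrightarrow> \<alpha> x \<Longrightarrow> \<beta> x" "\<forall>p \<in> S. valid_pair c n p"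
  shows "sat S \<beta>"
proof -
  have *: "arg_val \<beta> a" if "arg_val \<alpha> a" "valid_arg c n a" for a
    using that assms(2) by (cases a) auto
  show ?thesis
    using assms(1,3) * unfolding sat_def by fastforce
qed

text \<open>
  The pairs of vertices that become edges: \<open>S\<close> implies \<open>x\<^sub>i \<or> x\<^sub>j\<close>. The indices \<open>n\<close> and \<open>n + 1\<close>
  stand for variables that do not occur in \<open>S\<close>.
\<close>

definition implied :: "(arg \<times> arg) set \<Rightarrow> nat \<Rightarrow> nat \<Rightarrow> bool" where
  "implied S i j \<longleftrightarrow> \<not> sat S (\<lambda>x. x \<noteq> i \<and> x \<noteq> j)"

lemma implied_commute: "implied S i j = implied S j i"
  by (simp add: implied_def conj_commute)

text \<open>The graph determines the set up to equivalence. Fresh indices count as false, so an edge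
  from \<open>i\<close> to a fresh vertex demands x_i, and the edge between the fresh vertices is a
  contradiction. Conversely a falsified clause, its variables padded with fresh indices to two
  distinct ones, is an implied pair that is violated.\<close>

lemma sat_iff_implied:
  assumes "\<forall>p \<in> S. valid_pair c n p"
  shows "sat S \<alpha> \<longleftrightarrow> (\<forall>i < n + 2. \<forall>j < n + 2. i \<noteq> j \<longrightarrow> implied S i j \<longrightarrow>
    (i < n \<and> \<alpha> i) \<or> (j < n \<and> \<alpha> j))"
proof (intro iffI allI impI)
  fix i j assume *: "sat S \<alpha>" "implied S i j"
  show "(i < n \<and> \<alpha> i) \<or> (j < n \<and> \<alpha> j)"
  proof (rule ccontr)
    assume "\<not> ?thesis"
    then have "sat S (\<lambda>x. x \<noteq> i \<and> x \<noteq> j)"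
      using sat_mono[OF *(1) _ assms, of "\<lambda>x. x \<noteq> i \<and> x \<noteq> j"] by auto
    then show False using *(2) by (simp add: implied_def)
  qed
next
  assume *: "\<forall>i < n + 2. \<forall>j < n + 2. i \<noteq> j \<longrightarrow> implied S i j \<longrightarrow> (i < n \<and> \<alpha> i) \<or> (j < n \<and> \<alpha> j)"
  show "sat S \<alpha>"
  proof (rule ccontr)
    assume "\<not> sat S \<alpha>"
    then obtain a b where ab: "(a, b) \<in> S" "\<not> arg_val \<alpha> a" "\<not> arg_val \<alpha> b"
      unfolding sat_def by auto
    then have v: "valid_arg c n a" "valid_arg c n b" using assms by auto
    have impl: "implied S i j" if "\<not> arg_val (\<lambda>x. x \<noteq> i \<and> x \<noteq> j) a" "\<not> arg_val (\<lambda>x. x \<noteq> i \<and> x \<noteq> j) b"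
      for i j
      using that ab(1) unfolding implied_def sat_def by auto
    show False
    proof (cases a; cases b)
      fix x y assume "a = Var x" "b = Var y"
      moreover obtain j where "j < n + 2" "j \<noteq> x" "j = y \<or> x = y \<and> j = n"
        using v calculation by (cases "x = y") auto
      ultimately show False using *[rule_format, of x j] impl[of x j] ab v by auto
    next
      fix x d assume "a = Var x" "b = Const d"
      then show False using *[rule_format, of x n] impl[of x n] ab v by auto
    next
      fix x d assume "a = Const d" "b = Var x"
      then show False using *[rule_format, of x n] impl[of x n] ab v by auto
    next
      \<comment> \<open>Without any variable both places have to be padded, which takes two fresh
        indices.\<close>
      fix d d' assume "a = Const d" "b = Const d'"
      then show False using *[rule_format, of n "n + 1"] impl[of n "n + 1"] ab v by auto
    qed
  qed
qed

text \<open>As \<open>z\<close> does not occur in \<open>S\<close>, failing with \<open>x\<close>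
  and \<open>z\<close> false means failing with only \<open>x\<close> false, and making another
  \<open>y\<close> false cannot repair that.\<close>

lemma implied_fresh_iff:
  assumes "\<forall>p \<in> S. valid_pair c n p" "n \<le> z" "z < n + 2" "x \<noteq> z"
  shows "implied S x z \<longleftrightarrow> (\<forall>y < n + 2. y \<noteq> x \<longrightarrow> implied S x y)"
proof (intro iffI allI impI)
  fix y assume "implied S x z"
  then show "implied S x y"
    using sat_mono[OF _ _ assms(1), of "\<lambda>v. v \<noteq> x \<and> v \<noteq> y" "\<lambda>v. v \<noteq> x \<and> v \<noteq> z"] assms(2)
    unfolding implied_def by auto
qed (use assms in auto)

lemma implied_permuted:
  assumes "bij \<pi>" "\<And>\<alpha>. sat S (\<alpha> \<circ> \<pi>) \<longleftrightarrow> sat U \<alpha>"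
  shows "implied S i j \<longleftrightarrow> implied U (\<pi> i) (\<pi> j)"
proof -
  have "(\<lambda>x. x \<noteq> \<pi> i \<and> x \<noteq> \<pi> j) \<circ> \<pi> = (\<lambda>x. x \<noteq> i \<and> x \<noteq> j)"
    using bij_is_inj[OF assms(1)] by (auto simp: fun_eq_iff dest: injD)
  then show ?thesis
    using assms(2)[of "\<lambda>x. x \<noteq> \<pi> i \<and> x \<noteq> \<pi> j"] unfolding implied_def by simp
qed

text \<open>
  If the neighbours of \<open>z\<close> are the dominating vertices in both graphs, then so are those of \<open>g z\<close>
  in the second graph, and exchanging \<open>g z\<close> and \<open>z\<close> is an automorphism of it.
\<close>

lemma isomorphism_fixing:
  assumes g: "g permutes V" and z: "z \<in> V"
    and sym: "\<And>i j. b' i j = b' j i"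
    and iso: "\<And>i j. i \<in> V \<Longrightarrow> j \<in> V \<Longrightarrow> i \<noteq> j \<Longrightarrow> b i j \<longleftrightarrow> b' (g i) (g j)"
    and dom: "\<And>x. x \<in> V \<Longrightarrow> x \<noteq> z \<Longrightarrow> b x z \<longleftrightarrow> (\<forall>y \<in> V. y \<noteq> x \<longrightarrow> b x y)"
    and dom': "\<And>x. x \<in> V \<Longrightarrow> x \<noteq> z \<Longrightarrow> b' x z \<longleftrightarrow> (\<forall>y \<in> V. y \<noteq> x \<longrightarrow> b' x y)"
  defines "h \<equiv> transpose (g z) z \<circ> g"
  shows "h permutes V" "h z = z" "\<And>x. x \<noteq> z \<Longrightarrow> g x = x \<Longrightarrow> h x = x"
    "\<And>i j. i \<in> V \<Longrightarrow> j \<in> V \<Longrightarrow> i \<noteq> j \<Longrightarrow> b i j \<longleftrightarrow> b' (h i) (h j)"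
proof -
  have gV: "g x \<in> V \<longleftrightarrow> x \<in> V" for x using permutes_in_image[OF g] .
  have ginj: "g x = g y \<longleftrightarrow> x = y" for x y using permutes_inj[OF g] by (auto dest: injD)
  show "h permutes V"
    unfolding h_def by (intro permutes_compose[OF g] permutes_swap_id) (use gV z in auto)
  show "h z = z" by (simp add: h_def)
  show "h x = x" if "x \<noteq> z" "g x = x" for x
    using that ginj[of x z] by (simp add: h_def transpose_def)
  have twin: "b' x (g z) \<longleftrightarrow> b' x z" if x: "x \<in> V" "x \<noteq> g z" "x \<noteq> z" for x
  proof -
    obtain x' where x': "x = g x'" "x' \<in> V" "x' \<noteq> z"
      using x permutes_image[OF g] by auto
    have "b' x (g z) \<longleftrightarrow> b x' z" using iso x' z by simp
    also have "\<dots> \<longleftrightarrow> (\<forall>y \<in> V. y \<noteq> x' \<longrightarrow> b x' y)" using dom x' by blast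
    also have "\<dots> \<longleftrightarrow> (\<forall>y \<in> V. y \<noteq> x' \<longrightarrow> b' x (g y))" using iso x' by auto
    also have "\<dots> \<longleftrightarrow> (\<forall>y \<in> g ` V. y \<noteq> x \<longrightarrow> b' x y)" using x' ginj by auto
    also have "\<dots> \<longleftrightarrow> b' x z" using dom'[OF x(1,3)] permutes_image[OF g] by simp
    finally show ?thesis .
  qed
  have twin': "b' (g z) x \<longleftrightarrow> b' z x" if "x \<in> V" "x \<noteq> g z" "x \<noteq> z" for x
    using twin[OF that] sym[of x "g z"] sym[of x z] by blast
  \<comment> \<open>Pairs with one element among \<open>z\<close> and \<open>g z\<close> are handled
    by the twin property; the pair of these two is merely reversed, where symmetry helps.\<close>
  have "b' (transpose (g z) z i) (transpose (g z) z j) \<longleftrightarrow> b' i j"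
    if "i \<in> V" "j \<in> V" "i \<noteq> j" for i j
    using that twin[of i] twin[of j] twin'[of i] twin'[of j] sym[of z "g z"]
    by (auto simp: transpose_def)
  then show "b i j \<longleftrightarrow> b' (h i) (h j)" if "i \<in> V" "j \<in> V" "i \<noteq> j" for i j
    using that iso gV ginj unfolding h_def by simp
qed

lemma clauses_isomorphic_iff:
  assumes S: "\<forall>p \<in> S. valid_pair c n p" and U: "\<forall>p \<in> U. valid_pair c n p"
  shows "clauses_isomorphic n S U \<longleftrightarrow> (\<exists>g. g permutes {..<n + 2} \<and>
    (\<forall>i < n + 2. \<forall>j < n + 2. i \<noteq> j \<longrightarrow> (implied S i j \<longleftrightarrow> implied U (g i) (g j))))"
proof
  assume "clauses_isomorphic n S U"
  then obtain \<pi> where \<pi>: "\<pi> permutes {..<n}" "\<And>\<alpha>. sat S (\<alpha> \<circ> \<pi>) \<longleftrightarrow> sat U \<alpha>"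
    unfolding clauses_isomorphic_def by blast
  have "\<pi> permutes {..<n + 2}" using \<pi>(1) by (rule permutes_subset) auto
  then show "\<exists>g. g permutes {..<n + 2} \<and>
    (\<forall>i < n + 2. \<forall>j < n + 2. i \<noteq> j \<longrightarrow> (implied S i j \<longleftrightarrow> implied U (g i) (g j)))"
    using implied_permuted[OF permutes_bij[OF \<pi>(1)] \<pi>(2)] by blast
next
  let ?V = "{..<n + 2}"
  assume "\<exists>g. g permutes ?V \<and>
    (\<forall>i < n + 2. \<forall>j < n + 2. i \<noteq> j \<longrightarrow> (implied S i j \<longleftrightarrow> implied U (g i) (g j)))"
  then obtain g where g: "g permutes ?V"
    "\<And>i j. i \<in> ?V \<Longrightarrow> j \<in> ?V \<Longrightarrow> i \<noteq> j \<Longrightarrow> implied S i j \<longleftrightarrow> implied U (g i) (g j)"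
    by auto
  have domS: "implied S x z \<longleftrightarrow> (\<forall>y \<in> ?V. y \<noteq> x \<longrightarrow> implied S x y)"
    if "z = n \<or> z = n + 1" "x \<noteq> z" for x z
    using implied_fresh_iff[OF S, of z x] that by auto
  have domU: "implied U x z \<longleftrightarrow> (\<forall>y \<in> ?V. y \<noteq> x \<longrightarrow> implied U x y)"
    if "z = n \<or> z = n + 1" "x \<noteq> z" for x z
    using implied_fresh_iff[OF U, of z x] that by auto
  define g1 where "g1 = transpose (g n) n \<circ> g"
  note fix1 = isomorphism_fixing[OF g(1) _ implied_commute g(2) domS[OF disjI1[OF refl]]
      domU[OF disjI1[OF refl]], folded g1_def]
  have g1: "g1 permutes ?V" "g1 n = n"
    "\<And>i j. i \<in> ?V \<Longrightarrow> j \<in> ?V \<Longrightarrow> i \<noteq> j \<Longrightarrow> implied S i j \<longleftrightarrow> implied U (g1 i) (g1 j)"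
    by (rule fix1; simp)+
  \<comment> \<open>The second exchange does not move \<open>n\<close>: \<open>g1\<close> fixes
    \<open>n\<close>, and \<open>n\<close> differs from \<open>n + 1\<close>, so the third
    conclusion of \<open>isomorphism_fixing\<close> applies.\<close>
  define g2 where "g2 = transpose (g1 (n + 1)) (n + 1) \<circ> g1"
  note fix2 = isomorphism_fixing[OF g1(1) _ implied_commute g1(3) domS[OF disjI2[OF refl]]
      domU[OF disjI2[OF refl]], folded g2_def]
  have g2: "g2 permutes ?V" "g2 (n + 1) = n + 1" "g2 n = n"
    "\<And>i j. i \<in> ?V \<Longrightarrow> j \<in> ?V \<Longrightarrow> i \<noteq> j \<Longrightarrow> implied S i j \<longleftrightarrow> implied U (g2 i) (g2 j)"
    by (rule fix2; simp add: g1(2))+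
  have \<pi>: "g2 permutes {..<n}"
    using g2(1)
  proof (rule permutes_superset)
    fix x assume "x \<in> ?V - {..<n}"
    then have "x = n \<or> x = n + 1" by auto
    then show "g2 x = x" using g2 by auto
  qed
  have in_n: "g2 x < n \<longleftrightarrow> x < n" for x using permutes_in_image[OF \<pi>, of x] by simp
  have inj: "g2 x = g2 y \<longleftrightarrow> x = y" for x y using permutes_inj[OF \<pi>] by (auto dest: injD)
  have "sat S (\<alpha> \<circ> g2) \<longleftrightarrow> sat U \<alpha>" for \<alpha>
  proof -
    \<comment> \<open>Writing the index set as an image under \<open>g2\<close> turns pairs implied
      by \<open>U\<close> into pairs implied by \<open>S\<close>. Since \<open>g2\<close> maps
      variables to variables, the conditions \<open>i < n\<close> are preserved.\<close>
    have "sat U \<alpha> \<longleftrightarrow> (\<forall>i \<in> g2 ` ?V. \<forall>j \<in> g2 ` ?V. i \<noteq> j \<longrightarrow> implied U i j \<longrightarrow>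
        (i < n \<and> \<alpha> i) \<or> (j < n \<and> \<alpha> j))"
      unfolding sat_iff_implied[OF U] permutes_image[OF g2(1)] by auto
    also have "\<dots> \<longleftrightarrow> (\<forall>i \<in> ?V. \<forall>j \<in> ?V. i \<noteq> j \<longrightarrow> implied S i j \<longrightarrow>
        (i < n \<and> \<alpha> (g2 i)) \<or> (j < n \<and> \<alpha> (g2 j)))"
      using g2(4) by (simp add: inj in_n)
    also have "\<dots> \<longleftrightarrow> sat S (\<alpha> \<circ> g2)"
      unfolding sat_iff_implied[OF S] by auto
    finally show ?thesis by simp
  qed
  then show "clauses_isomorphic n S U"
    unfolding clauses_isomorphic_def using \<pi> by blast
qed

section \<open>Graphs of clause sets\<close>

lemma bij_betw_permutes:
  assumes "bij_betw f A A"
  obtains g where "g permutes A" "\<And>x. x \<in> A \<Longrightarrow> g x = f x"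
proof
  show "(\<lambda>x. if x \<in> A then f x else x) permutes A"
    using assms by (auto intro!: bij_imp_permutes simp: bij_betw_def inj_on_def image_def)
qed simp

lemma graph_isomorphic_permutes:
  "graph_isomorphic (n, es) (n, fs) \<longleftrightarrow> (\<exists>g. g permutes {..<n} \<and>
    (\<forall>u < n. \<forall>v < n. {u, v} \<in> edges (n, es) \<longleftrightarrow> {g u, g v} \<in> edges (n, fs)))"
  (is "_ \<longleftrightarrow> ?R")
proof
  assume "graph_isomorphic (n, es) (n, fs)"
  then obtain f where f: "bij_betw f {..<n} {..<n}"
    "\<forall>u < n. \<forall>v < n. {u, v} \<in> edges (n, es) \<longleftrightarrow> {f u, f v} \<in> edges (n, fs)"
    unfolding graph_isomorphic_def by auto
  obtain g where "g permutes {..<n}" "\<And>x. x \<in> {..<n} \<Longrightarrow> g x = f x"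
    using bij_betw_permutes[OF f(1)] by blast
  then show ?R using f(2) by (intro exI[of _ g]) auto
next
  assume ?R
  then show "graph_isomorphic (n, es) (n, fs)"
    unfolding graph_isomorphic_def using permutes_imp_bij by fastforce
qed

lemma no_loops: "wf_graph (n, es) \<Longrightarrow> {u, u} \<notin> edges (n, es)"
  by (auto simp: doubleton_eq_iff)

lemma set_star: "set (star m a) = Pair a ` {j. j < m \<and> j \<noteq> a}"
  by (auto simp: star_def)

lemma pair_edges_iff:
  assumes "valid_pair c n p" "i \<noteq> j" "i < n + 2" "j < n + 2"
  shows "{i, j} \<in> (\<lambda>(u, v). {u, v}) ` set (pair_edges n p) \<longleftrightarrow> implied {p} i j"
proof -
  obtain a b where p: "p = (a, b)" by (cases p)
  have star: "{i, j} \<in> (\<lambda>(u, v). {u, v}) ` set (star (n + 2) x) \<longleftrightarrow> x = i \<or> x = j" for x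
    using assms by (auto simp: set_star doubleton_eq_iff image_iff)
  have "(i, j) \<in> set (concat (map (star (n + 2)) [0..<n + 2]))"
    using assms by (auto simp: set_star simp del: upt_Suc)
  then have stars: "{i, j} \<in> (\<lambda>(u, v). {u, v}) ` set (concat (map (star (n + 2)) [0..<n + 2]))"
    by (intro image_eqI[of _ _ "(i, j)"]) simp_all
  show ?thesis
  proof (cases "a = Const False \<and> b = Const False")
    case True
    then have "pair_edges n p = concat (map (star (n + 2)) [0..<n + 2])"
      by (simp add: p code_edges_def del: upt_Suc)
    then show ?thesis using stars True by (simp only:) (simp add: p implied_def sat_def)
  next
    case False
    then show ?thesis
      using assms star
      by (cases a; cases b) (auto simp: p implied_def sat_def code_edges_def Let_def doubleton_eq_iff)
  qed
qed

text \<open>Implication of a pair is failure at one assignment, and a conjunction fails there iff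
  some member does. This is why the edges can be printed clause by clause.\<close>

lemma implied_Union: "implied S i j \<longleftrightarrow> (\<exists>p \<in> S. implied {p} i j)"
  by (auto simp: implied_def sat_def)

lemma edges_clause_graph:
  assumes "\<forall>p \<in> set ps. valid_pair c n p" "i \<noteq> j" "i < n + 2" "j < n + 2"
  shows "{i, j} \<in> edges (clause_graph n ps) \<longleftrightarrow> implied (set ps) i j"
proof -
  have "{i, j} \<in> edges (clause_graph n ps) \<longleftrightarrow>
      (\<exists>p \<in> set ps. {i, j} \<in> (\<lambda>(u, v). {u, v}) ` set (pair_edges n p))"
    by (auto simp: clause_graph_def image_iff)
  also have "\<dots> \<longleftrightarrow> (\<exists>p \<in> set ps. implied {p} i j)"
    using assms by (intro bex_cong[OF refl] pair_edges_iff) auto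
  finally show ?thesis using implied_Union by blast
qed

lemma wf_clause_graph:
  assumes "\<forall>p \<in> set ps. valid_pair c n p"
  shows "wf_graph (clause_graph n ps)"
proof -
  have "u < n + 2 \<and> v < n + 2 \<and> u \<noteq> v" if "valid_pair c n p" "(u, v) \<in> set (pair_edges n p)" for p u v
  proof -
    obtain a b where p: "p = (a, b)" by (cases p)
    show ?thesis
      using that by (cases a; cases b) (auto simp: p set_star code_edges_def Let_def split: if_splits)
  qed
  then show ?thesis using assms by (fastforce simp: clause_graph_def)
qed

lemma clause_graph_isomorphic:
  assumes S: "\<forall>p \<in> set ps. valid_pair c n p" and U: "\<forall>p \<in> set qs. valid_pair c n p"
  shows "graph_isomorphic (clause_graph n ps) (clause_graph n qs) \<longleftrightarrow>
    clauses_isomorphic n (set ps) (set qs)"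
proof -
  \<comment> \<open>Graph isomorphism also speaks about \<open>u = v\<close>, where both sides are
    false for lack of loops, whereas \<open>implied\<close> is compared at distinct indices
    only.\<close>
  have eq: "({u, v} \<in> edges (clause_graph n ps) \<longleftrightarrow> {g u, g v} \<in> edges (clause_graph n qs)) \<longleftrightarrow>
      (u \<noteq> v \<longrightarrow> (implied (set ps) u v \<longleftrightarrow> implied (set qs) (g u) (g v)))"
    if g: "g permutes {..<n + 2}" and uv: "u < n + 2" "v < n + 2" for g u v
  proof (cases "u = v")
    case True
    then show ?thesis
      using no_loops wf_clause_graph[OF S] wf_clause_graph[OF U] unfolding clause_graph_def by metis
  next
    case False
    then have "g u \<noteq> g v" using permutes_inj[OF g] by (auto dest: injD)
    moreover have "g u < n + 2" "g v < n + 2"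
      using permutes_in_image[OF g] uv by blast+
    ultimately show ?thesis
      using edges_clause_graph[OF S False uv] edges_clause_graph[OF U] False by simp
  qed
  show ?thesis
    unfolding clauses_isomorphic_iff[OF S U] using eq
    unfolding clause_graph_def graph_isomorphic_permutes by blast
qed

section \<open>Clause sets of graphs\<close>

definition var_pair :: "nat \<times> nat \<Rightarrow> arg \<times> arg" where
  "var_pair e = (Var (fst e), Var (snd e))"

lemma clause_app_eq: "clause_app = pair_app \<circ> var_pair"
  by (auto simp: clause_app_def var_pair_def)

lemma sat_var_pairs_iff:
  "sat (var_pair ` set es) \<alpha> \<longleftrightarrow> (\<forall>(u, v) \<in> set es. \<alpha> u \<or> \<alpha> v)"
  by (simp add: sat_def var_pair_def split_beta)

lemma edge_iff: "{i, j} \<in> edges (n, es) \<longleftrightarrow> (i, j) \<in> set es \<or> (j, i) \<in> set es"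
  by (force simp: doubleton_eq_iff image_iff split_beta)

text \<open>Well-formedness enters through the absence of loops: a clause x_u or x_u would imply
  every pair that contains \<open>u\<close>.\<close>

lemma implied_var_pairs:
  assumes "wf_graph (n, es)" "i \<noteq> j"
  shows "implied (var_pair ` set es) i j \<longleftrightarrow> {i, j} \<in> edges (n, es)"
proof -
  have "implied (var_pair ` set es) i j \<longleftrightarrow>
      (\<exists>(u, v) \<in> set es. (u = i \<or> u = j) \<and> (v = i \<or> v = j))"
    unfolding implied_def sat_var_pairs_iff by auto
  also have "\<dots> \<longleftrightarrow> (i, j) \<in> set es \<or> (j, i) \<in> set es"
    using assms by auto
  finally show ?thesis unfolding edge_iff .
qed

lemma sat_var_pairs:
  assumes "wf_graph (n, es)"
  shows "sat (var_pair ` set es) \<alpha> \<longleftrightarrow>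
    (\<forall>i \<in> {..<n}. \<forall>j \<in> {..<n}. {i, j} \<in> edges (n, es) \<longrightarrow> \<alpha> i \<or> \<alpha> j)"
  unfolding sat_var_pairs_iff edge_iff using assms by fastforce

lemma var_pairs_isomorphic:
  assumes G: "wf_graph (n, es)" and H: "wf_graph (n, fs)"
  shows "clauses_isomorphic n (var_pair ` set es) (var_pair ` set fs) \<longleftrightarrow>
    graph_isomorphic (n, es) (n, fs)"
proof
  assume "clauses_isomorphic n (var_pair ` set es) (var_pair ` set fs)"
  then obtain \<pi> where \<pi>: "\<pi> permutes {..<n}"
    "\<And>\<alpha>. sat (var_pair ` set es) (\<alpha> \<circ> \<pi>) \<longleftrightarrow> sat (var_pair ` set fs) \<alpha>"
    unfolding clauses_isomorphic_def by blast
  have "{u, v} \<in> edges (n, es) \<longleftrightarrow> {\<pi> u, \<pi> v} \<in> edges (n, fs)" for u v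
  proof (cases "u = v")
    case True
    then show ?thesis using no_loops[OF G, of u] no_loops[OF H, of "\<pi> u"] by simp
  next
    case False
    then have "\<pi> u \<noteq> \<pi> v" using permutes_inj[OF \<pi>(1)] by (auto dest: injD)
    then show ?thesis
      using implied_permuted[OF permutes_bij[OF \<pi>(1)] \<pi>(2)] implied_var_pairs[OF G False]
        implied_var_pairs[OF H] by blast
  qed
  then show "graph_isomorphic (n, es) (n, fs)"
    using \<pi>(1) unfolding graph_isomorphic_permutes by blast
next
  assume "graph_isomorphic (n, es) (n, fs)"
  then obtain g where g: "g permutes {..<n}"
    "\<forall>u < n. \<forall>v < n. {u, v} \<in> edges (n, es) \<longleftrightarrow> {g u, g v} \<in> edges (n, fs)"
    unfolding graph_isomorphic_permutes by blast
  have "sat (var_pair ` set es) (\<alpha> \<circ> g) \<longleftrightarrow> sat (var_pair ` set fs) \<alpha>" for \<alpha>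
  proof -
    have "sat (var_pair ` set fs) \<alpha> \<longleftrightarrow>
        (\<forall>i \<in> g ` {..<n}. \<forall>j \<in> g ` {..<n}. {i, j} \<in> edges (n, fs) \<longrightarrow> \<alpha> i \<or> \<alpha> j)"
      unfolding sat_var_pairs[OF H] permutes_image[OF g(1)] ..
    also have "\<dots> \<longleftrightarrow> sat (var_pair ` set es) (\<alpha> \<circ> g)"
      unfolding sat_var_pairs[OF G] using g(2) by auto
    finally show ?thesis by simp
  qed
  then show "clauses_isomorphic n (var_pair ` set es) (var_pair ` set fs)"
    unfolding clauses_isomorphic_def using g(1) by blast
qed


section \<open>The reductions\<close>

text \<open>The flag \<open>c\<close> lets one argument treat the problems with and without
  constants.\<close>

definition iso_problem :: "bool \<Rightarrow> bool list set" where
  "iso_problem c = (if c then ISO\<^sub>c [or_constraint] else ISO [or_constraint])"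

lemma valid_arg_iff:
  "valid_arg c n a \<longleftrightarrow> a \<in> Var ` {..<n} \<union> (if c then range Const else {})"
  by (cases a) auto

text \<open>The constraint is nonempty, so the inclusion in \<open>applications\<close> forces
  exactly two arguments.\<close>

lemma valid_apps_or_iff:
  assumes T: "T = Var ` {..<n} \<union> (if c then range Const else {})"
  shows "valid_apps [or_constraint] T as \<longleftrightarrow>
    (\<exists>ps. as = map pair_app ps \<and> (\<forall>p \<in> set ps. valid_pair c n p))"
proof
  assume *: "valid_apps [or_constraint] T as"
  have "\<exists>p. x = pair_app p \<and> valid_pair c n p" if x: "x \<in> set as" for x
  proof -
    obtain i xs where ixs: "x = (i, xs)" by (cases x)
    have i: "i = 0" using * x ixs by (auto simp: valid_apps_def)
    have "(or_constraint, xs) \<in> apps_of [or_constraint] as"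
      using x ixs i by (force simp: apps_of_def)
    then have "(or_constraint, xs) \<in> applications (set [or_constraint]) T"
      using * by (auto simp: valid_apps_def)
    then have xs: "or_constraint \<subseteq> {t. length t = length xs}" "set xs \<subseteq> T"
      by (simp_all add: applications_def)
    have "length xs = 2" using xs(1) by auto
    then obtain a b where ab: "xs = [a, b]"
      by (auto simp: length_Suc_conv numeral_2_eq_2)
    have "valid_pair c n (a, b)" using xs(2) ab T by (simp add: valid_arg_iff)
    then show ?thesis using ixs i ab by (intro exI[of _ "(a, b)"]) simp
  qed
  then obtain f where f: "\<And>x. x \<in> set as \<Longrightarrow> x = pair_app (f x) \<and> valid_pair c n (f x)"
    by metis
  have "as = map pair_app (map f as)" using f by (simp add: map_idI)
  then show "\<exists>ps. as = map pair_app ps \<and> (\<forall>p \<in> set ps. valid_pair c n p)"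
    using f by (intro exI[of _ "map f as"]) auto
next
  assume "\<exists>ps. as = map pair_app ps \<and> (\<forall>p \<in> set ps. valid_pair c n p)"
  then show "valid_apps [or_constraint] T as"
    unfolding T by (fastforce simp: valid_apps_def apps_of_def applications_def valid_arg_iff)
qed

lemma iso_problem_iff:
  "w \<in> iso_problem c \<longleftrightarrow> (\<exists>n ps qs. w = enc_pairs (n, ps, qs) \<and> valid_pairs c (n, ps, qs) \<and>
    clauses_isomorphic n (set ps) (set qs))"
proof -
  let ?T = "\<lambda>n. Var ` {..<n} \<union> (if c then range Const else {})"
  have "w \<in> iso_problem c \<longleftrightarrow> (\<exists>n as bs. w = enc_iso n as bs \<and>
      valid_apps [or_constraint] (?T n) as \<and> valid_apps [or_constraint] (?T n) bs \<and>
      isomorphic_over {..<n} (apps_of [or_constraint] as) (apps_of [or_constraint] bs))"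
    by (simp add: iso_problem_def ISO_def ISO\<^sub>c_def)
  also have "\<dots> \<longleftrightarrow> (\<exists>n ps qs. w = enc_pairs (n, ps, qs) \<and> valid_pairs c (n, ps, qs) \<and>
    isomorphic_over {..<n} (apps_of [or_constraint] (map pair_app ps))
      (apps_of [or_constraint] (map pair_app qs)))"
    unfolding valid_apps_or_iff[OF refl] by auto
  finally show ?thesis unfolding isomorphic_over_pairs .
qed

lemma inj_pair_app: "inj pair_app"
  by (auto simp: inj_def)

lemma enc_pairs_inject: "enc_pairs t = enc_pairs t' \<longleftrightarrow> t = t'"
  by (cases t; cases t') (auto simp: enc_iso_inject inj_map_eq_map[OF inj_pair_app])

lemma enc_app_prefix_free: "enc_app a @ u = enc_app b @ v \<longleftrightarrow> a = b \<and> u = v"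
proof -
  have "enc_arg x @ u = enc_arg y @ v \<longleftrightarrow> x = y \<and> u = v" for x y u v
    by (cases x; cases y) (auto simp: enc_nat_prefix_free)
  then show ?thesis
    by (auto simp: enc_app_def enc_nat_prefix_free enc_list_prefix_free prod_eq_iff)
qed

lemma enc_pairs_prefix_free:
  assumes "enc_pairs t @ r = enc_pairs t'"
  shows "t = t' \<and> r = []"
proof -
  have "enc_pairs t @ r = enc_pairs t' @ []" using assms by simp
  then show ?thesis
    by (cases t; cases t') (simp add: enc_iso_def enc_nat_prefix_free
      enc_list_prefix_free[OF enc_app_prefix_free] inj_map_eq_map[OF inj_pair_app] del: append_Nil2)
qed

lemma enc_graphs_prefix_free:
  assumes "enc_graphs t @ r = enc_graphs t'"
  shows "t = t' \<and> r = []"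
  using assms enc_graph_prefix_free[of "snd t" r "snd t'" "[]"]
  by (cases t; cases t') (auto simp: enc_graph_prefix_free)

lemma enc_clause_sets_eq:
  "enc_clause_sets ((n, es), (m, fs)) = enc_pairs (n, map var_pair es, map var_pair fs)"
  by (simp add: clause_app_eq)

text \<open>The empty word is the image of every rejected input, so it must be a negative
  instance.\<close>

lemma Nil_notin_iso_problem: "[] \<notin> iso_problem c"
  by (simp add: iso_problem_iff enc_iso_def enc_nat_def)

lemma Nil_notin_GI: "[] \<notin> GI"
  by (simp add: GI_def enc_graph_def enc_nat_def)

lemma enc_graphs_in_GI_iff:
  "enc_graphs (G, H) \<in> GI \<longleftrightarrow> wf_graph G \<and> wf_graph H \<and> graph_isomorphic G H"
  unfolding GI_def
  using enc_graphs_prefix_free[of "(G, H)" "[]"] by fastforce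

text \<open>The clauses produced contain no constants, so the same map works for both values of
  \<open>c\<close>.\<close>

lemma GI_reducible: "GI \<le>\<^sub>p iso_problem c"
proof -
  obtain f where f: "polytime f" "\<And>x. loop_free x \<Longrightarrow> f (enc_graphs x) = enc_clause_sets x"
    "\<And>w. (\<And>x. w = enc_graphs x \<Longrightarrow> \<not> loop_free x) \<Longrightarrow> f w = []"
    \<comment> \<open>\<open>lessI\<close> discharges \<open>5 < K\<close> by choosing 6 counters;
      the reduction in the other direction gets 10 in the same way.\<close>
    using polytime_parser[OF parses_graph_clauses[OF lessI] enc_graphs_prefix_free] by blast
  have "w \<in> GI \<longleftrightarrow> f w \<in> iso_problem c" for w
  proof (cases "\<exists>x. w = enc_graphs x \<and> loop_free x")
    case True
    then obtain n es fs where w: "w = enc_graphs ((n, es), (n, fs))" and lf: "loop_free ((n, es), (n, fs))"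
      by auto
    let ?ps = "map var_pair es" and ?qs = "map var_pair fs"
    have "f w \<in> iso_problem c \<longleftrightarrow> enc_pairs (n, ?ps, ?qs) \<in> iso_problem c"
      using f(2)[OF lf] w enc_clause_sets_eq by simp
    also have "\<dots> \<longleftrightarrow> valid_pairs c (n, ?ps, ?qs) \<and> clauses_isomorphic n (set ?ps) (set ?qs)"
      unfolding iso_problem_iff enc_pairs_inject by auto
    also have "\<dots> \<longleftrightarrow> wf_graph (n, es) \<and> wf_graph (n, fs) \<and> clauses_isomorphic n (set ?ps) (set ?qs)"
      using lf by (fastforce simp: var_pair_def)
    also have "\<dots> \<longleftrightarrow> w \<in> GI"
      unfolding w enc_graphs_in_GI_iff set_map using var_pairs_isomorphic by blast
    finally show ?thesis ..
  next
    case False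
    have "w \<notin> GI"
    proof
      assume "w \<in> GI"
      then obtain n es m fs where w: "w = enc_graphs ((n, es), (m, fs))" and
        wf: "wf_graph (n, es)" "wf_graph (m, fs)" and iso: "graph_isomorphic (n, es) (m, fs)"
        unfolding GI_def by auto
      have "n = m" using iso by (auto simp: graph_isomorphic_def dest: bij_betw_same_card)
      then have "loop_free ((n, es), (m, fs))" using wf by auto
      then show False using False w by blast
    qed
    moreover have "f w = []" using False f(3) by blast
    ultimately show ?thesis using Nil_notin_iso_problem by simp
  qed
  then show ?thesis unfolding poly_reducible_def using f(1) by blast
qed

lemma reducible_GI: "iso_problem c \<le>\<^sub>p GI"
proof -
  obtain f where f: "polytime f" "\<And>x. valid_pairs c x \<Longrightarrow> f (enc_pairs x) = enc_clause_graphs x"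
    "\<And>w. (\<And>x. w = enc_pairs x \<Longrightarrow> \<not> valid_pairs c x) \<Longrightarrow> f w = []"
    using polytime_parser[OF parses_clause_graphs[OF lessI] enc_pairs_prefix_free, of c] by blast
  have "w \<in> iso_problem c \<longleftrightarrow> f w \<in> GI" for w
  proof (cases "\<exists>x. w = enc_pairs x \<and> valid_pairs c x")
    case True
    then obtain n ps qs where w: "w = enc_pairs (n, ps, qs)" and v: "valid_pairs c (n, ps, qs)"
      by (metis prod.exhaust)
    then have S: "\<forall>p \<in> set ps. valid_pair c n p" and U: "\<forall>p \<in> set qs. valid_pair c n p" by auto
    have "w \<in> iso_problem c \<longleftrightarrow> clauses_isomorphic n (set ps) (set qs)"
      unfolding w iso_problem_iff enc_pairs_inject using v by auto
    also have "\<dots> \<longleftrightarrow> enc_graphs (clause_graph n ps, clause_graph n qs) \<in> GI"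
      unfolding enc_graphs_in_GI_iff clause_graph_isomorphic[OF S U]
      using wf_clause_graph[OF S] wf_clause_graph[OF U] by simp
    finally show ?thesis using f(2)[OF v] w by simp
  next
    case False
    then have "w \<notin> iso_problem c" unfolding iso_problem_iff by blast
    moreover have "f w = []" using False f(3) by blast
    ultimately show ?thesis using Nil_notin_GI by simp
  qed
  then show ?thesis unfolding poly_reducible_def using f(1) by blast
qed

theorem theorem22:
  "GI \<equiv>\<^sub>p ISO [{[False, True], [True, False], [True, True]}] \<and>
   GI \<equiv>\<^sub>p ISO\<^sub>c [{[False, True], [True, False], [True, True]}]"
  using GI_reducible[of False] reducible_GI[of False] GI_reducible[of True] reducible_GI[of True]
  by (simp add: poly_equivalent_def iso_problem_def)

end
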